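(* The space $HK[\mathbb{R}^n]$ of all HK-integrable functions is contained in $SD^2[\mathbb{R}^n]$.
   Context: HK-integrable means Henstock–Kurzweil integrable. $\lambda_n$ is Lebesgue measure. Jones functions: for $x\in\mathbb{R}$, $0\le y<\infty$, $1<a<\infty$, let $g(x,y)=\exp\{-y^a e^{iax}\}$, and let $h(x)=\int_0^\infty g(x,y)\,dy$ for $x\in(-\frac{\pi}{2a},\frac{\pi}{2a})$ and $h(x)=0$ otherwise. On $(-\frac{\pi}{2a},\frac{\pi}{2a})$ one has $h(x)=h(0)e^{-ix}$ with $h(0)=\Gamma(\frac1a+1)$. For $k\in\mathbb{N}$ let $a_k=\pi2^{k-1}$, let $h_k$ be $h$ with $a=a_k$ (so nonzero on $(-\frac1{2^k},\frac1{2^k})$), and $\varepsilon_k=\frac{1}{2^{k+1}}$. For a rational $x^i$ let $f_k^i(x)=c_k\exp\{\varepsilon_k^2/(|x-x^i|^2-\varepsilon_k^2)\}$ if $|x-x^i|<\varepsilon_k$ and $0$ otherwise, $c_k$ the standard normalizing constant, and let $I_k^i$ be the closed interval of half-length $\varepsilon_k$ supporting $f_k^i$. Set $\chi_k^i=f_k^i*h_k$, $\alpha_{k,i}=\int_{I_k^i}e^{iz}f_k^i(z)\,dz$, and $\xi_k^i(x)=\alpha_{k,i}^{-1}\chi_k^i(-x)$, with the normalization $$\xi_k^i(x)=\tfrac1n e^{i(x-x^i)}\ (x\in I_k^i),\qquad \xi_k^i(x)=0\ (x\notin I_k^i).$$ The space: enumerate the rational points as $\mathbb{Q}^n=\{\mathbf{x}^1,\mathbf{x}^2,\dots\}$;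 let $\mathbf{B}_k(\mathbf{x}^i)$ be the closed cube centered at $\mathbf{x}^i$ with edge $\frac{1}{2^k\sqrt n}$; using the natural bijection $\mathbb{N}\times\mathbb{N}\leftrightarrow\mathbb{N}$, $(k,i)\leftrightarrow m$, list these as $\{\mathbf{B}_m\}$. For $m=(k,i)$ put $\mathcal{E}_m(\mathbf{x})=(\xi_k^i(x_1),\xi_k^i(x_2),\dots,\xi_k^i(x_n))$, where in the $j$-th entry the centre of $\xi_k^i$ is the $j$-th coordinate of $\mathbf{x}^i$; $|\mathcal{E}_m(\mathbf{x})|<1$ for $\mathbf{x}\in\prod_{j=1}^n I_k^i$ and $\mathcal{E}_m(\mathbf{x})=0$ otherwise. The $\mathcal{E}_m$ are regarded as $C_c^\infty$ functions. Put $t_m=2^{-m}$ and let $\mathbf{L}^1[\mathbb{R}^n]=L^1[\mathbb{R}^n]^n$. Then $SD^2[\mathbb{R}^n]$ is the completion of $\mathbf{L}^1[\mathbb{R}^n]$ with respect to $$(f,g)=\sum_{m=1}^\infty t_m\Big[\int_{\mathbb{R}^n}\mathcal{E}_m\cdot f\,d\lambda_n\Big]\overline{\Big[\int_{\mathbb{R}^n}\mathcal{E}_m\cdot g\,d\lambda_n\Big]}.$$ Functions in $SD^2$ have $n$ components, and HK-integrability is understood componentwise accordingly; for HK-integrable $f$ the integrals $\int\mathcal{E}_m\cdot f\,d\lambda_n$ are HK-integrals. *)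

theory Defs
  imports "HOL-Analysis.Analysis"
begin

section \<open>The Henstock--Kurzweil integral on all of R^n\<close>

text \<open>
  On the unbounded domain R^n the Henstock--Kurzweil integral is the gauge integral over the
  compact interval formed by all of the extended space (\<^typ>\<open>ereal ^ 'n\<close>): tagged divisions of the
  whole extended space by closed intervals, fine for a gauge that also assigns neighbourhoods to the
  points at infinity, and with the integrand extended by 0 to those points.

  The library's \<^term>\<open>f integrable_on UNIV\<close> is an improper integral over large boxes around the
  origin. For n = 1 it is the same notion, but for n > 1 it also admits functions whose integrals
  over unit cubes grow arbitrarily fast, with cancellation inside every large box (for instance
  f (x, y) = c (floor y) * sgn x for 0 < |x| < 1 and y > 0, f = 0 otherwise, with c arbitrary). Such
  functions are not Henstock--Kurzweil integrable on R^n.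
\<close>

definition ext_tagged_division :: "((ereal ^ 'n) \<times> (ereal ^ 'n) set) set \<Rightarrow> bool" where
  "ext_tagged_division p \<longleftrightarrow>
     finite p \<and>
     (\<forall>x K. (x, K) \<in> p \<longrightarrow> x \<in> K \<and> (\<exists>a b. K = {a..b})) \<and>
     (\<forall>x1 K1 x2 K2. (x1, K1) \<in> p \<and> (x2, K2) \<in> p \<and> (x1, K1) \<noteq> (x2, K2) \<longrightarrow>
        interior K1 \<inter> interior K2 = {}) \<and>
     \<Union> (snd ` p) = UNIV"

definition ext_extend :: "(real ^ 'n \<Rightarrow> 'b::real_vector) \<Rightarrow> ereal ^ 'n \<Rightarrow> 'b" where
  "ext_extend f x =
     (if \<forall>j. \<bar>x $ j\<bar> \<noteq> \<infinity> then f (\<chi> j. real_of_ereal (x $ j)) else 0)"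

text \<open>
  The n-dimensional volume of an extended interval. Unbounded intervals get the value 0. This
  is immaterial: their contribution is 0 by the convention 0 * infinity = 0 when the tag is at
  infinity, and a gauge can be shrunk so that finite tags only occur with bounded intervals.
\<close>
definition ext_content :: "(ereal ^ 'n) set \<Rightarrow> real" where
  "ext_content K = measure lborel {x :: real ^ 'n. (\<chi> j. ereal (x $ j)) \<in> K}"

definition hk_has_integral ::
    "(real ^ 'n \<Rightarrow> 'b::real_normed_vector) \<Rightarrow> 'b \<Rightarrow> bool" where
  "hk_has_integral f I \<longleftrightarrow>
     (\<forall>\<epsilon>>0. \<exists>\<gamma>. gauge \<gamma> \<and>
        (\<forall>p. ext_tagged_division p \<and> \<gamma> fine p \<longrightarrow>
           norm ((\<Sum>(x, K)\<in>p. ext_content K *\<^sub>R ext_extend f x) - I) < \<epsilon>))"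

definition hk_integrable :: "(real ^ 'n \<Rightarrow> 'b::real_normed_vector) \<Rightarrow> bool" where
  "hk_integrable f \<longleftrightarrow> (\<exists>I. hk_has_integral f I)"

definition hk_integral :: "(real ^ 'n \<Rightarrow> 'b::real_normed_vector) \<Rightarrow> 'b" where
  "hk_integral f = (THE I. hk_has_integral f I)"

definition HK :: "(real ^ 'n \<Rightarrow> complex ^ 'n) set" where
  "HK = {f. \<forall>j. hk_integrable (\<lambda>x. f x $ j)}"

definition L1 :: "(real ^ 'n \<Rightarrow> complex ^ 'n) set" where
  "L1 = {f. \<forall>j. integrable lebesgue (\<lambda>x. f x $ j)}"


section \<open>The functionals\<close>

text \<open>
  All indices \<open>m\<close>, \<open>k\<close>, \<open>i\<close> start at 1. The enumeration \<open>q\<close> of the rational points and the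
  bijection \<open>idx\<close> from \<open>m\<close> to \<open>(k, i)\<close> are parameters.
\<close>

definition jones_interval :: "nat \<Rightarrow> real \<Rightarrow> real set" where
  "jones_interval k c = {c - 1 / 2 ^ (k + 1) .. c + 1 / 2 ^ (k + 1)}"

text \<open>
  The normalized Jones function in dimension \<open>n\<close> with centre \<open>c\<close>, in its explicit form. It is
  smooth on its supporting interval and jumps to 0 at the end points.
\<close>
definition jones_xi :: "nat \<Rightarrow> nat \<Rightarrow> real \<Rightarrow> real \<Rightarrow> complex" where
  "jones_xi n k c x =
     (if x \<in> jones_interval k c
      then 1 / of_nat n * exp (\<i> * complex_of_real (x - c)) else 0)"

text \<open>
  The vector of the one-dimensional functions vanishes off the product cube; without the
  explicit cut-off its individual components would be supported on unbounded slabs.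
\<close>
definition sd_E ::
    "(nat \<Rightarrow> real ^ 'n) \<Rightarrow> (nat \<Rightarrow> nat \<times> nat) \<Rightarrow> nat \<Rightarrow> real ^ 'n \<Rightarrow> complex ^ 'n" where
  "sd_E q idx m x =
     (case idx m of (k, i) \<Rightarrow>
        if \<forall>j. x $ j \<in> jones_interval k (q i $ j)
        then \<chi> j. jones_xi CARD('n) k (q i $ j) (x $ j) else 0)"

definition sd_dot ::
    "(nat \<Rightarrow> real ^ 'n) \<Rightarrow> (nat \<Rightarrow> nat \<times> nat) \<Rightarrow> nat \<Rightarrow>
     (real ^ 'n \<Rightarrow> complex ^ 'n) \<Rightarrow> real ^ 'n \<Rightarrow> complex" where
  "sd_dot q idx m f x = (\<Sum>j\<in>UNIV. sd_E q idx m x $ j * f x $ j)"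

definition sd_moment ::
    "(nat \<Rightarrow> real ^ 'n) \<Rightarrow> (nat \<Rightarrow> nat \<times> nat) \<Rightarrow> (real ^ 'n \<Rightarrow> complex ^ 'n) \<Rightarrow>
     nat \<Rightarrow> complex" where
  "sd_moment q idx f m = integral\<^sup>L lebesgue (sd_dot q idx m f)"

definition hk_moment ::
    "(nat \<Rightarrow> real ^ 'n) \<Rightarrow> (nat \<Rightarrow> nat \<times> nat) \<Rightarrow> (real ^ 'n \<Rightarrow> complex ^ 'n) \<Rightarrow>
     nat \<Rightarrow> complex" where
  "hk_moment q idx f m = hk_integral (sd_dot q idx m f)"


section \<open>The space SD2\<close>

definition sd_form :: "(nat \<Rightarrow> complex) \<Rightarrow> (nat \<Rightarrow> complex) \<Rightarrow> complex" where
  "sd_form u v = (\<Sum>m. 1 / 2 ^ Suc m * (u (Suc m) * cnj (v (Suc m))))"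

definition sd_inner ::
    "(nat \<Rightarrow> real ^ 'n) \<Rightarrow> (nat \<Rightarrow> nat \<times> nat) \<Rightarrow>
     (real ^ 'n \<Rightarrow> complex ^ 'n) \<Rightarrow> (real ^ 'n \<Rightarrow> complex ^ 'n) \<Rightarrow> complex" where
  "sd_inner q idx f g = sd_form (sd_moment q idx f) (sd_moment q idx g)"

definition sd_norm ::
    "(nat \<Rightarrow> real ^ 'n) \<Rightarrow> (nat \<Rightarrow> nat \<times> nat) \<Rightarrow> (real ^ 'n \<Rightarrow> complex ^ 'n) \<Rightarrow> real" where
  "sd_norm q idx f = sqrt (Re (sd_inner q idx f f))"

text \<open>
  The completion of \<^term>\<open>L1\<close>: Cauchy sequences modulo null sequences.
\<close>
definition sd_Cauchy ::
    "(nat \<Rightarrow> real ^ 'n) \<Rightarrow> (nat \<Rightarrow> nat \<times> nat) \<Rightarrow>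
     (nat \<Rightarrow> real ^ 'n \<Rightarrow> complex ^ 'n) set" where
  "sd_Cauchy q idx =
     {X. (\<forall>l. X l \<in> L1) \<and>
         (\<forall>\<epsilon>>0. \<exists>N. \<forall>l\<ge>N. \<forall>l'\<ge>N. sd_norm q idx (\<lambda>x. X l x - X l' x) < \<epsilon>)}"

definition sd_null_rel ::
    "(nat \<Rightarrow> real ^ 'n) \<Rightarrow> (nat \<Rightarrow> nat \<times> nat) \<Rightarrow>
     (nat \<Rightarrow> real ^ 'n \<Rightarrow> complex ^ 'n) rel" where
  "sd_null_rel q idx =
     {(X, Y). X \<in> sd_Cauchy q idx \<and> Y \<in> sd_Cauchy q idx \<and>
              (\<lambda>l. sd_norm q idx (\<lambda>x. X l x - Y l x)) \<longlonglongrightarrow> 0}"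

definition SD2 ::
    "(nat \<Rightarrow> real ^ 'n) \<Rightarrow> (nat \<Rightarrow> nat \<times> nat) \<Rightarrow>
     (nat \<Rightarrow> real ^ 'n \<Rightarrow> complex ^ 'n) set set" where
  "SD2 q idx = sd_Cauchy q idx // sd_null_rel q idx"

text \<open>
  The element of the completion given by a function \<open>f\<close>: all sequences in \<^term>\<open>L1\<close> that converge
  to \<open>f\<close> in the norm of SD2, extended to \<open>f\<close> by reading its integrals as Henstock--Kurzweil
  integrals. The set is empty, hence not an element of \<^term>\<open>SD2 q idx\<close>, if one of these integrals
  does not exist, if \<open>f\<close> has infinite norm, or if \<open>f\<close> is not a limit of functions in \<^term>\<open>L1\<close>.
\<close>
definition sd_class ::
    "(nat \<Rightarrow> real ^ 'n) \<Rightarrow> (nat \<Rightarrow> nat \<times> nat) \<Rightarrow> (real ^ 'n \<Rightarrow> complex ^ 'n) \<Rightarrow>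
     (nat \<Rightarrow> real ^ 'n \<Rightarrow> complex ^ 'n) set" where
  "sd_class q idx f =
     {X. (\<forall>l. X l \<in> L1) \<and>
         (\<forall>m\<ge>1. hk_integrable (sd_dot q idx m f)) \<and>
         summable (\<lambda>m. 1 / 2 ^ Suc m * (cmod (hk_moment q idx f (Suc m)))\<^sup>2) \<and>
         (\<lambda>l. let d = (\<lambda>m. sd_moment q idx (X l) m - hk_moment q idx f m)
              in sqrt (Re (sd_form d d))) \<longlonglongrightarrow> 0}"

end

theory Submission
  imports Defs
begin

hide_const (open) Polynomial.content

text \<open>
  Call the number \<open>hk_moment q idx f m\<close> the \<open>m\<close>-th moment of \<open>f\<close>. The class of \<open>f\<close> lies in the
  completion as soon as the moments of \<open>f\<close> exist, are square summable with the weights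
  \<open>2^-m\<close>, and are limits, in the weighted square norm, of moments of integrable functions. All three
  facts come from one source: the functions obtained from \<open>f\<close> by multiplying with the vectors
  \<open>E_m\<close> form an \<^emph>\<open>equiintegrable\<close> family, that is, a single gauge controls their Riemann sums up to
  a given \<open>e\<close>, uniformly in \<open>m\<close>.

  Take one division that is fine for this gauge. Its Riemann sums are
  \<open>\<Sum>a. E_m(x_a) \<bullet> y_a\<close> with points \<open>x_a\<close> and vectors \<open>y_a\<close> that do not depend on \<open>m\<close>: they are the
  moments of a finite combination of point masses. Since \<open>\<bar>E_m\<bar> \<le> 1\<close>, these sums are bounded in \<open>m\<close>, and
  hence so are the moments of \<open>f\<close>. Moreover, the point masses have the right moments up to \<open>e\<close> for all
  \<open>m\<close> simultaneously, and point masses are easily approximated by integrable functions: replace the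
  mass at \<open>x\<close> by the normalized indicator of a small cube at \<open>x\<close>. This converges in every moment for
  which \<open>E_m\<close> is continuous at \<open>x\<close>, and boundedly, so dominated convergence gives convergence in the
  weighted square norm. The functions \<open>E_m\<close> jump only on the faces of their cubes, and these faces lie in
  countably many coordinate hyperplanes, a null set on which \<open>f\<close> may be set to zero beforehand
  (\<open>hk_moment_uniform_point_masses\<close>, \<open>square_sum_smeared_masses\<close>). The triangle inequality then
  identifies the set of approximating sequences with one equivalence class of Cauchy sequences.

  Equiintegrability is a theorem about compact boxes, whereas the integral here lives on the extended
  space. The arctangent of each coordinate maps the extended space homeomorphically onto the
  cube \<open>[-pi/2, pi/2]^n\<close>, intervals to intervals and tagged divisions to tagged divisions. A
  comparison of Riemann sums shows that \<open>f\<close> is integrable on the extended space exactly if its pullback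
  along the tangent, multiplied by the Jacobian and extended by 0 to the boundary, is gauge integrable
  on the cube (\<open>hk_has_integral_iff_pullback\<close>). On the cube, restrictions of an integrable function to
  boxes are equiintegrable, and a continuous function of bounded variation of a single coordinate,
  restricted to a box, is a pointwise limit of combinations of indicators of boxes with coefficients of
  bounded sum. Hence the multiplication with \<open>E_m\<close> preserves equiintegrability, uniformly in
  \<open>m\<close> (\<open>equiintegrable_coordinate_multipliers\<close>, \<open>equiintegrable_sd_dot\<close>).
\<close>

section \<open>The extended space as a compact cube\<close>

definition arctan_ereal :: "ereal \<Rightarrow> real" where
  "arctan_ereal x = (if x = \<infinity> then pi/2 else if x = -\<infinity> then -(pi/2) else arctan (real_of_ereal x))"

definition tan_ereal :: "real \<Rightarrow> ereal" where
  "tan_ereal u = (if u = pi/2 then \<infinity> else if u = -(pi/2) then -\<infinity> else ereal (tan u))"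

lemma arctan_ereal_simps [simp]:
  "arctan_ereal (ereal r) = arctan r" "arctan_ereal \<infinity> = pi/2" "arctan_ereal (-\<infinity>) = -(pi/2)"
  by (auto simp: arctan_ereal_def)

lemma arctan_ereal_bounds: "-(pi/2) \<le> arctan_ereal x" "arctan_ereal x \<le> pi/2"
  using arctan_lbound[of "real_of_ereal x"] arctan_ubound[of "real_of_ereal x"]
  by (auto simp: arctan_ereal_def)

lemma arctan_ereal_le_iff: "arctan_ereal x \<le> arctan_ereal y \<longleftrightarrow> x \<le> y"
proof -
  have "-(pi/2) < arctan r" "arctan r < pi/2" for r
    by (rule arctan_lbound arctan_ubound)+
  then show ?thesis
    using pi_gt_zero by (cases x; cases y) (simp_all add: arctan_le_iff less_imp_le not_le del: minus_divide_left)
qed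

lemma tan_ereal_arctan_ereal [simp]: "tan_ereal (arctan_ereal x) = x"
proof (cases x)
  case (real r)
  then show ?thesis
    using arctan_lbound[of r] arctan_ubound[of r] by (simp add: tan_ereal_def tan_arctan)
qed (auto simp: tan_ereal_def)

lemma arctan_ereal_tan_ereal:
  assumes "-(pi/2) \<le> u" "u \<le> pi/2"
  shows "arctan_ereal (tan_ereal u) = u"
  using assms by (auto simp: tan_ereal_def arctan_tan)

lemma tan_ereal_mono:
  assumes "u \<in> {-(pi/2)..pi/2}" "v \<in> {-(pi/2)..pi/2}" "u \<le> v"
  shows "tan_ereal u \<le> tan_ereal v"
  using assms by (simp flip: arctan_ereal_le_iff add: arctan_ereal_tan_ereal)

lemma image_tan_ereal: "tan_ereal ` {-(pi/2)..pi/2} = UNIV"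
proof -
  have "x \<in> tan_ereal ` {-(pi/2)..pi/2}" for x
    by (rule image_eqI[of _ _ "arctan_ereal x"]) (use arctan_ereal_bounds in auto)
  then show ?thesis by auto
qed

lemma continuous_on_tan_ereal: "continuous_on {-(pi/2)..pi/2} tan_ereal"
  by (rule continuous_onI_mono) (auto simp: image_tan_ereal tan_ereal_mono)

text \<open>
  The inverse of a continuous injection of a compact set is continuous, so no limit at infinity has
  to be computed.
\<close>

lemma continuous_on_arctan_ereal: "continuous_on UNIV arctan_ereal"
  using continuous_on_inv[OF continuous_on_tan_ereal, of arctan_ereal]
  by (simp add: image_tan_ereal arctan_ereal_tan_ereal)

text \<open>
  In \<open>arctan_vec\<close> and \<open>tan_vec\<close> the coordinatewise maps form a homeomorphism of the extended space with the
  cube of side \<open>pi\<close>. Continuity in both directions allows gauges to be carried over from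
  either space to the other.
\<close>

definition arctan_vec :: "ereal ^ 'n \<Rightarrow> real ^ 'n" where
  "arctan_vec x = (\<chi> j. arctan_ereal (x $ j))"

definition tan_vec :: "real ^ 'n \<Rightarrow> ereal ^ 'n" where
  "tan_vec u = (\<chi> j. tan_ereal (u $ j))"

abbreviation angle_cube :: "(real ^ 'n) set" where
  "angle_cube \<equiv> cbox (\<chi> j. -(pi/2)) (\<chi> j. pi/2)"

abbreviation open_angle_cube :: "(real ^ 'n) set" where
  "open_angle_cube \<equiv> box (\<chi> j. -(pi/2)) (\<chi> j. pi/2)"

lemma arctan_vec_in_cube: "arctan_vec x \<in> angle_cube"
  unfolding mem_box_cart arctan_vec_def vec_lambda_beta by (intro allI conjI arctan_ereal_bounds)

lemma tan_vec_arctan_vec [simp]: "tan_vec (arctan_vec x) = x"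
  by (simp add: tan_vec_def arctan_vec_def)

lemma arctan_vec_tan_vec: "u \<in> angle_cube \<Longrightarrow> arctan_vec (tan_vec u) = u"
  by (auto simp: tan_vec_def arctan_vec_def mem_box_cart arctan_ereal_tan_ereal vec_eq_iff)

lemma inj_arctan_vec: "inj arctan_vec"
  by (metis injI tan_vec_arctan_vec)

lemma continuous_on_arctan_vec: "continuous_on UNIV arctan_vec"
  unfolding arctan_vec_def
  by (intro continuous_on_vec_lambda continuous_on_compose2[OF continuous_on_arctan_ereal])
     (auto intro!: continuous_intros)

lemma continuous_on_tan_vec: "continuous_on angle_cube tan_vec"
  unfolding tan_vec_def
  by (intro continuous_on_vec_lambda continuous_on_compose2[OF continuous_on_tan_ereal])
     (auto intro!: continuous_intros simp: mem_box_cart)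

lemma image_arctan_vec: "arctan_vec ` UNIV = angle_cube"
proof
  show "angle_cube \<subseteq> range arctan_vec"
    by (metis arctan_vec_tan_vec rangeI subsetI)
qed (auto intro: arctan_vec_in_cube simp del: mem_box_cart)

lemma arctan_vec_image_interval: "arctan_vec ` {a..b} = cbox (arctan_vec a) (arctan_vec b)"
proof
  show "arctan_vec ` {a..b} \<subseteq> cbox (arctan_vec a) (arctan_vec b)"
    by (auto simp: arctan_vec_def mem_box_cart less_eq_vec_def arctan_ereal_le_iff)
  show "cbox (arctan_vec a) (arctan_vec b) \<subseteq> arctan_vec ` {a..b}"
  proof
    fix u assume u: "u \<in> cbox (arctan_vec a) (arctan_vec b)"
    have "u \<in> angle_cube"
      using u arctan_vec_in_cube[of a] arctan_vec_in_cube[of b]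
      unfolding mem_box_cart by (meson order_trans)
    then have eq: "arctan_vec (tan_vec u) = u" by (rule arctan_vec_tan_vec)
    have "tan_vec u \<in> {a..b}"
      using u by (subst (asm) eq[symmetric])
        (auto simp: arctan_vec_def mem_box_cart less_eq_vec_def arctan_ereal_le_iff)
    then show "u \<in> arctan_vec ` {a..b}" using eq by (metis imageI)
  qed
qed

text \<open>
  Interiors are taken in two different spaces, and they do differ: an interval containing a point at
  infinity can be a neighbourhood of it, whereas its image never is a neighbourhood of a boundary point
  of the cube. Whether the interior is empty is the same on both sides, because an open set that
  meets the cube also meets the open cube. This is all that matters for divisions.
\<close>

lemma interior_arctan_image_empty_iff:
  "interior (arctan_vec ` A) = {} \<longleftrightarrow> interior A = {}"
proof
  assume *: "interior (arctan_vec ` A) = {}"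
  show "interior A = {}"
  proof (rule ccontr)
    assume "interior A \<noteq> {}"
    then obtain x where x: "x \<in> interior A" by auto
    obtain T where T: "open T" "angle_cube \<inter> tan_vec -` interior A = T \<inter> angle_cube"
      using continuous_on_tan_vec open_interior[of A]
      unfolding continuous_on_open_invariant by (metis inf_commute)
    have "arctan_vec x \<in> T"
      using T(2) x arctan_vec_in_cube[of x] by auto
    moreover have "arctan_vec x \<in> closure open_angle_cube"
      using arctan_vec_in_cube[of x] by (subst closure_box) (auto simp: box_ne_empty inner_axis Basis_vec_def)
    ultimately have "T \<inter> open_angle_cube \<noteq> {}"
      using T(1) open_Int_closure_eq_empty by blast
    moreover have "T \<inter> open_angle_cube \<subseteq> arctan_vec ` A"
    proof
      fix u assume u: "u \<in> T \<inter> open_angle_cube"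
      then have "u \<in> angle_cube" using box_subset_cbox by blast
      then have "tan_vec u \<in> A" "arctan_vec (tan_vec u) = u"
        using T(2) u interior_subset[of A] arctan_vec_tan_vec by auto
      then show "u \<in> arctan_vec ` A" by (metis imageI)
    qed
    ultimately show False
      using * T(1) interior_maximal[of "T \<inter> open_angle_cube" "arctan_vec ` A"] open_box by blast
  qed
next
  assume *: "interior A = {}"
  show "interior (arctan_vec ` A) = {}"
  proof (rule ccontr)
    assume "interior (arctan_vec ` A) \<noteq> {}"
    then obtain u where u: "u \<in> interior (arctan_vec ` A)" by auto
    let ?V = "arctan_vec -` interior (arctan_vec ` A)"
    have "open ?V"
      by (rule open_vimage[OF open_interior continuous_on_arctan_vec])
    moreover have "?V \<subseteq> A"
    proof
      fix x assume "x \<in> ?V"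
      then have "arctan_vec x \<in> arctan_vec ` A" using interior_subset by blast
      then show "x \<in> A" by (simp add: inj_image_mem_iff inj_arctan_vec)
    qed
    ultimately have "?V = {}" using * interior_maximal by blast
    then show False using u interior_subset[of "arctan_vec ` A"] by blast
  qed
qed

section \<open>Tagged divisions of the extended space and of the cube\<close>

lemma interiors_disjoint_arctan_iff:
  "interior (arctan_vec ` K) \<inter> interior (arctan_vec ` L) = {} \<longleftrightarrow> interior K \<inter> interior L = {}"
proof -
  have "interior (arctan_vec ` K) \<inter> interior (arctan_vec ` L) = interior (arctan_vec ` (K \<inter> L))"
    by (simp only: image_Int[OF inj_arctan_vec] interior_Int)
  then show ?thesis by (simp only: interior_arctan_image_empty_iff interior_Int)
qed

text \<open>
  Applied to all members of a tagged division of the extended space it gives a tagged division of the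
  cube, and every tagged division of the cube arises in this way.
\<close>

definition arctan_tagged :: "(ereal ^ 'n) \<times> (ereal ^ 'n) set \<Rightarrow> (real ^ 'n) \<times> (real ^ 'n) set" where
  "arctan_tagged = map_prod arctan_vec (image arctan_vec)"

lemma inj_arctan_tagged: "inj arctan_tagged"
  unfolding arctan_tagged_def
  by (rule prod.inj_map[OF inj_arctan_vec]) (simp add: inj_def inj_image_eq_iff[OF inj_arctan_vec])

lemma arctan_tagged_division:
  assumes p: "ext_tagged_division p"
  shows "(arctan_tagged ` p) tagged_division_of angle_cube"
  unfolding tagged_division_of
proof (intro conjI allI impI)
  show "finite (arctan_tagged ` p)"
    using p by (simp add: ext_tagged_division_def)
  fix u K assume "(u, K) \<in> arctan_tagged ` p"
  then obtain x L where xL: "(x, L) \<in> p" "u = arctan_vec x" "K = arctan_vec ` L"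
    by (auto simp: arctan_tagged_def)
  then obtain a b where ab: "x \<in> L" "L = {a..b}"
    using p unfolding ext_tagged_division_def by metis
  show "u \<in> K" using xL ab by blast
  show "K \<subseteq> angle_cube" using xL arctan_vec_in_cube by blast
  show "\<exists>a b. K = cbox a b" using xL ab arctan_vec_image_interval by blast
next
  fix u1 K1 u2 K2
  assume *: "(u1, K1) \<in> arctan_tagged ` p \<and> (u2, K2) \<in> arctan_tagged ` p \<and> (u1, K1) \<noteq> (u2, K2)"
  then obtain z1 z2 where z: "z1 \<in> p" "(u1, K1) = arctan_tagged z1" "z2 \<in> p" "(u2, K2) = arctan_tagged z2"
    by blast
  obtain x1 L1 x2 L2 where z': "z1 = (x1, L1)" "z2 = (x2, L2)" by fastforce
  have "interior L1 \<inter> interior L2 = {}"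
  proof -
    have "(x1, L1) \<noteq> (x2, L2)" using z z' * by auto
    then show ?thesis using p z z' unfolding ext_tagged_division_def by blast
  qed
  then show "interior K1 \<inter> interior K2 = {}"
    using z z' by (simp add: arctan_tagged_def interiors_disjoint_arctan_iff)
next
  have "\<Union>{K. \<exists>x. (x, K) \<in> arctan_tagged ` p} = arctan_vec ` (\<Union> (snd ` p))"
    by (force simp: arctan_tagged_def)
  also have "\<dots> = angle_cube"
    using p image_arctan_vec by (simp add: ext_tagged_division_def)
  finally show "\<Union>{K. \<exists>x. (x, K) \<in> arctan_tagged ` p} = angle_cube" .
qed

lemma image_arctan_tan_vec: "K \<subseteq> angle_cube \<Longrightarrow> arctan_vec ` tan_vec ` K = K"
  by (force simp: arctan_vec_tan_vec image_image subset_iff)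

lemma tan_vec_image_cbox:
  assumes "cbox c d \<subseteq> angle_cube" "cbox c d \<noteq> {}"
  shows "tan_vec ` cbox c d = {tan_vec c..tan_vec d}"
proof -
  have "c \<in> cbox c d" "d \<in> cbox c d"
    using assms(2) by (auto simp: box_ne_empty(1) mem_box)
  then have "arctan_vec ` {tan_vec c..tan_vec d} = cbox c d"
    using assms(1) by (simp add: arctan_vec_image_interval arctan_vec_tan_vec subset_iff)
  also have "\<dots> = arctan_vec ` tan_vec ` cbox c d"
    using image_arctan_tan_vec[OF assms(1)] by simp
  finally show ?thesis
    by (simp add: inj_image_eq_iff[OF inj_arctan_vec])
qed

lemma tagged_division_of_angle_cubeE:
  assumes q: "q tagged_division_of angle_cube"
  obtains p where "ext_tagged_division p" "arctan_tagged ` p = q"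
proof
  let ?p = "map_prod tan_vec (image tan_vec) ` q"
  have cube: "u \<in> angle_cube" "K \<subseteq> angle_cube" if "(u, K) \<in> q" for u K
    using q that unfolding tagged_division_of by blast+
  have inverse: "arctan_tagged (map_prod tan_vec (image tan_vec) z) = z" if "z \<in> q" for z
    using that cube[of "fst z" "snd z"]
    by (cases z) (simp add: arctan_tagged_def arctan_vec_tan_vec image_arctan_tan_vec)
  then show image: "arctan_tagged ` ?p = q"
    by (force simp: image_image)
  show "ext_tagged_division ?p"
    unfolding ext_tagged_division_def
  proof (intro conjI allI impI)
    show "finite ?p" using q by (simp add: tagged_division_of)
    fix x L assume "(x, L) \<in> ?p"
    then obtain u K where uK: "(u, K) \<in> q" "x = tan_vec u" "L = tan_vec ` K" by auto
    with q obtain c d where "u \<in> K" "K = cbox c d" unfolding tagged_division_of by metis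
    with uK cube[OF uK(1)] show "x \<in> L" "\<exists>a b. L = {a..b}"
      using tan_vec_image_cbox by blast+
  next
    fix x1 L1 x2 L2
    assume *: "(x1, L1) \<in> ?p \<and> (x2, L2) \<in> ?p \<and> (x1, L1) \<noteq> (x2, L2)"
    then have "arctan_tagged (x1, L1) \<in> q" "arctan_tagged (x2, L2) \<in> q"
      "arctan_tagged (x1, L1) \<noteq> arctan_tagged (x2, L2)"
      using image by (auto simp only: inj_eq[OF inj_arctan_tagged])
    then show "interior L1 \<inter> interior L2 = {}"
      using q unfolding tagged_division_of arctan_tagged_def
      by (simp add: interiors_disjoint_arctan_iff[symmetric])
  next
    have "\<Union> (snd ` ?p) = tan_vec ` \<Union>{K. \<exists>x. (x, K) \<in> q}" by force
    also have "\<dots> = tan_vec ` angle_cube" using q by (simp add: tagged_division_of)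
    also have "\<dots> = UNIV" by (metis arctan_vec_in_cube imageI surjI UNIV_eq_I tan_vec_arctan_vec)
    finally show "\<Union> (snd ` ?p) = UNIV" .
  qed
qed

section \<open>The integral on the extended space as an integral on the cube\<close>

text \<open>
  At a boundary point some cosine vanishes, and by the convention \<open>1 / 0 = 0\<close> the Jacobian is 0 there. So
  the pullback of a function is automatically 0 on the boundary, which matches the extension by 0 to
  the points at infinity.
\<close>

definition tan_jacobian :: "real ^ 'n \<Rightarrow> real" where
  "tan_jacobian u = (\<Prod>j\<in>UNIV. 1 / (cos (u $ j))\<^sup>2)"

definition pullback :: "(real ^ 'n \<Rightarrow> 'b::real_vector) \<Rightarrow> real ^ 'n \<Rightarrow> 'b" where
  "pullback f u = tan_jacobian u *\<^sub>R f (\<chi> j. tan (u $ j))"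

lemma finite_iff_arctan_vec: "(\<forall>j. \<bar>x $ j\<bar> \<noteq> \<infinity>) \<longleftrightarrow> arctan_vec x \<in> open_angle_cube"
proof -
  have "\<bar>y\<bar> \<noteq> \<infinity> \<longleftrightarrow> -(pi/2) < arctan_ereal y \<and> arctan_ereal y < pi/2" for y
  proof (cases y)
    case (real r)
    then show ?thesis using arctan_lbound[of r] arctan_ubound[of r] by simp
  qed auto
  then show ?thesis by (simp only: mem_box_cart arctan_vec_def vec_lambda_beta)
qed

lemma tan_jacobian_boundary: "u \<in> angle_cube - open_angle_cube \<Longrightarrow> tan_jacobian u = 0"
proof -
  assume u: "u \<in> angle_cube - open_angle_cube"
  then obtain j where "u $ j = pi/2 \<or> u $ j = -(pi/2)"
    unfolding mem_box_cart Diff_iff vec_lambda_beta by (metis order.not_eq_order_implies_strict)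
  then have "cos (u $ j) = 0" by (elim disjE) (simp_all only: cos_minus cos_pi_half)
  then show ?thesis unfolding tan_jacobian_def by (auto intro!: prod_zero bexI[of _ j])
qed

lemma cos_pos_open_cube: "u \<in> open_angle_cube \<Longrightarrow> 0 < cos (u $ j)"
  unfolding mem_box_cart vec_lambda_beta by (intro cos_gt_zero_pi) auto

lemma continuous_on_tan_jacobian: "continuous_on open_angle_cube tan_jacobian"
  unfolding tan_jacobian_def
  by (intro continuous_intros) (simp add: cos_pos_open_cube[THEN less_imp_neq, symmetric])

lemma ext_content_eq:
  assumes "arctan_vec ` {a..b} \<subseteq> open_angle_cube" "{a..b} \<noteq> {}"
  shows "ext_content {a..b} = (\<Prod>j\<in>UNIV. tan (arctan_vec b $ j) - tan (arctan_vec a $ j))"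
proof -
  have le: "a \<le> b" using assms(2) by (auto intro: order_trans simp: less_eq_vec_def)
  have "arctan_vec a \<in> open_angle_cube" "arctan_vec b \<in> open_angle_cube"
    using assms le by (auto simp: image_subset_iff less_eq_vec_def)
  then have fin: "\<bar>a $ j\<bar> \<noteq> \<infinity>" "\<bar>b $ j\<bar> \<noteq> \<infinity>" for j
    by (metis finite_iff_arctan_vec)+
  define A B where "A = (\<chi> j. real_of_ereal (a $ j))" and "B = (\<chi> j. real_of_ereal (b $ j))"
  have AB: "a $ j = ereal (A $ j)" "b $ j = ereal (B $ j)" for j
    using fin[of j] by (auto simp: A_def B_def ereal_real)
  have leAB: "A $ j \<le> B $ j" for j
    using le by (simp add: less_eq_vec_def AB)
  have "{x :: real ^ 'a. (\<chi> j. ereal (x $ j)) \<in> {a..b}} = cbox A B"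
    by (auto simp: mem_box_cart less_eq_vec_def AB)
  then have "ext_content {a..b} = content (cbox A B)"
    by (simp add: ext_content_def)
  also have "\<dots> = (\<Prod>j\<in>UNIV. B $ j - A $ j)"
    by (rule content_cbox_cart) (use leAB in \<open>auto simp: interval_ne_empty_cart\<close>)
  finally show ?thesis by (simp add: arctan_vec_def AB tan_arctan)
qed

text \<open>
  The volume of the image of a box under the coordinatewise tangent is the Jacobian at an intermediate
  point times the volume of the box, by the mean value theorem in each coordinate.
\<close>

lemma tan_product_mvt:
  fixes c d :: "real ^ 'n"
  assumes "cbox c d \<subseteq> open_angle_cube" "cbox c d \<noteq> {}"
  obtains z where "z \<in> cbox c d"
    "(\<Prod>j\<in>UNIV. tan (d $ j) - tan (c $ j)) = tan_jacobian z * content (cbox c d)"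
proof -
  have cd: "c \<in> cbox c d" "d \<in> cbox c d"
    using assms(2) by (auto simp: box_ne_empty(1) mem_box)
  then have le: "c $ j \<le> d $ j" for j by (auto simp: mem_box_cart)
  have "\<exists>z. c $ j \<le> z \<and> z \<le> d $ j \<and> tan (d $ j) - tan (c $ j) = (d $ j - c $ j) * (1 / (cos z)\<^sup>2)" for j
  proof (cases "c $ j = d $ j")
    case False
    then have "c $ j < d $ j" using le[of j] by simp
    have "cos x \<noteq> 0" if "c $ j \<le> x" "x \<le> d $ j" for x
    proof -
      have "-(pi/2) < c $ j" "d $ j < pi/2"
        using cd assms(1) by (auto simp: mem_box_cart subset_iff)
      then show ?thesis using that cos_gt_zero_pi[of x] by simp
    qed
    then have "\<exists>z. c $ j < z \<and> z < d $ j \<and> tan (d $ j) - tan (c $ j) = (d $ j - c $ j) * inverse ((cos z)\<^sup>2)"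
      by (intro MVT2[OF \<open>c $ j < d $ j\<close>] DERIV_tan) auto
    then show ?thesis by (auto simp: inverse_eq_divide intro!: less_imp_le)
  qed auto
  then obtain z where z: "\<And>j. c $ j \<le> z j \<and> z j \<le> d $ j \<and> tan (d $ j) - tan (c $ j) = (d $ j - c $ j) * (1 / (cos (z j))\<^sup>2)"
    by metis
  show ?thesis
  proof
    show "(\<chi> j. z j) \<in> cbox c d" using z by (simp add: mem_box_cart)
    have "(\<Prod>j\<in>UNIV. tan (d $ j) - tan (c $ j)) = (\<Prod>j\<in>UNIV. (d $ j - c $ j) * (1 / (cos (z j))\<^sup>2))"
      using z by simp
    also have "\<dots> = content (cbox c d) * tan_jacobian (\<chi> j. z j)"
      by (simp only: prod.distrib content_cbox_cart[OF assms(2)] tan_jacobian_def vec_lambda_beta)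
    finally show "(\<Prod>j\<in>UNIV. tan (d $ j) - tan (c $ j)) = tan_jacobian (\<chi> j. z j) * content (cbox c d)"
      by (simp add: mult.commute)
  qed
qed

text \<open>
  By continuity of the Jacobian, on small intervals the two ways of measuring differ by an
  arbitrarily small fraction of the volume in the cube.
\<close>

lemma ext_content_approx:
  fixes u :: "real ^ 'n"
  assumes u: "u \<in> open_angle_cube" and "e > 0"
  obtains r where "r > 0" and
    "\<And>a b. arctan_vec ` {a..b} \<subseteq> ball u r \<Longrightarrow> {a..b} \<noteq> {} \<Longrightarrow>
       \<bar>ext_content {a..b} - content (arctan_vec ` {a..b}) * tan_jacobian u\<bar> \<le> e * content (arctan_vec ` {a..b})"
proof -
  have "continuous (at u) tan_jacobian"
    using continuous_on_tan_jacobian u by (metis continuous_on_eq_continuous_at open_box)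
  then obtain r1 where r1: "r1 > 0" "\<And>v. dist v u < r1 \<Longrightarrow> dist (tan_jacobian v) (tan_jacobian u) < e"
    using \<open>e > 0\<close> unfolding continuous_at_eps_delta by metis
  obtain r2 where r2: "r2 > 0" "ball u r2 \<subseteq> open_angle_cube"
    using u open_box open_contains_ball by metis
  show ?thesis
  proof
    show "min r1 r2 > 0" using r1 r2 by simp
    fix a b :: "ereal ^ 'n"
    assume sub: "arctan_vec ` {a..b} \<subseteq> ball u (min r1 r2)" and ne: "{a..b} \<noteq> {}"
    let ?c = "arctan_vec a" and ?d = "arctan_vec b"
    have L: "arctan_vec ` {a..b} = cbox ?c ?d" by (rule arctan_vec_image_interval)
    have sub': "cbox ?c ?d \<subseteq> ball u r1" "cbox ?c ?d \<subseteq> open_angle_cube"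
      using sub r2(2) subset_ball[of "min r1 r2" r1 u] subset_ball[of "min r1 r2" r2 u]
      unfolding L by (metis min.cobounded1 order_trans, metis min.cobounded2 order_trans)
    have ne': "cbox ?c ?d \<noteq> {}" using ne L by blast
    obtain z where z: "z \<in> cbox ?c ?d"
      "(\<Prod>j\<in>UNIV. tan (?d $ j) - tan (?c $ j)) = tan_jacobian z * content (cbox ?c ?d)"
      using tan_product_mvt[OF sub'(2) ne'] .
    have "\<bar>tan_jacobian z - tan_jacobian u\<bar> \<le> e"
      using r1(2)[of z] z(1) sub'(1) by (auto simp: dist_real_def dist_commute)
    then have "\<bar>tan_jacobian z - tan_jacobian u\<bar> * content (cbox ?c ?d) \<le> e * content (cbox ?c ?d)"
      by (rule mult_right_mono) simp
    moreover have "ext_content {a..b} = tan_jacobian z * content (cbox ?c ?d)"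
      using ext_content_eq[of a b] sub'(2) ne z(2) unfolding L by metis
    then have "ext_content {a..b} - content (cbox ?c ?d) * tan_jacobian u
        = (tan_jacobian z - tan_jacobian u) * content (cbox ?c ?d)"
      by (simp only: left_diff_distrib mult.commute)
    ultimately show "\<bar>ext_content {a..b} - content (arctan_vec ` {a..b}) * tan_jacobian u\<bar> \<le> e * content (arctan_vec ` {a..b})"
      unfolding arctan_vec_image_interval by (simp only: abs_mult abs_of_nonneg content_pos_le)
  qed
qed

lemma norm_diff_less_halves:
  fixes a b c :: "'b::real_normed_vector"
  assumes "norm (a - b) \<le> e/2" "norm (b - c) < e/2"
  shows "norm (a - c) < e"
  using norm_triangle_ineq[of "a - b" "b - c"] assms by simp

text \<open>
  The two Riemann sums are compared term by term. At a tag \<open>u\<close> inside the cube the error of the volume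
  is made smaller than the volume times \<open>e\<close> divided by \<open>1 + norm (f (tan u))\<close>; the factor with \<open>f\<close>
  cancels the value of the integrand, and the volumes of the pieces add up to the volume of the cube. At a tag
  on the boundary both terms vanish, so there the gauge may be arbitrary.
\<close>

lemma riemann_sum_approx:
  fixes f :: "real ^ 'n \<Rightarrow> 'b::real_normed_vector"
  assumes "e > 0"
  obtains \<gamma> where "gauge \<gamma>" and
    "\<And>p. ext_tagged_division p \<Longrightarrow> \<gamma> fine (arctan_tagged ` p) \<Longrightarrow>
       norm ((\<Sum>(x, K)\<in>p. ext_content K *\<^sub>R ext_extend f x)
           - (\<Sum>(u, K)\<in>arctan_tagged ` p. content K *\<^sub>R pullback f u)) \<le> e"
proof -
  let ?C = "content (angle_cube :: (real ^ 'n) set)"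
  let ?t = "\<lambda>u :: real ^ 'n. f (\<chi> j. tan (u $ j))"
  define \<eta> where "\<eta> u = e / ((1 + ?C) * (1 + norm (?t u)))" for u
  have C: "0 \<le> ?C" by simp
  have \<eta>: "\<eta> u > 0" for u
    unfolding \<eta>_def using \<open>e > 0\<close> C
    by (intro divide_pos_pos mult_pos_pos) (auto intro: add_pos_nonneg)
  have "\<exists>r>0. \<forall>a b. arctan_vec ` {a..b} \<subseteq> ball u r \<longrightarrow> {a..b} \<noteq> {} \<longrightarrow>
       \<bar>ext_content {a..b} - content (arctan_vec ` {a..b}) * tan_jacobian u\<bar> \<le> \<eta> u * content (arctan_vec ` {a..b})"
    if "u \<in> open_angle_cube" for u :: "real ^ 'n"
    using ext_content_approx[OF that \<eta>] by metis
  then obtain r where r: "\<And>u. u \<in> open_angle_cube \<Longrightarrow> r u > 0"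
    "\<And>u a b. u \<in> open_angle_cube \<Longrightarrow> arctan_vec ` {a..b} \<subseteq> ball u (r u) \<Longrightarrow> {a..b} \<noteq> {} \<Longrightarrow>
       \<bar>ext_content {a..b} - content (arctan_vec ` {a..b}) * tan_jacobian u\<bar> \<le> \<eta> u * content (arctan_vec ` {a..b})"
    by metis
  define \<gamma> where "\<gamma> u = (if u \<in> open_angle_cube then ball u (r u) else UNIV)" for u
  show ?thesis
  proof
    show "gauge \<gamma>" using r(1) by (auto simp: gauge_def \<gamma>_def)
    fix p :: "((ereal ^ 'n) \<times> (ereal ^ 'n) set) set"
    assume p: "ext_tagged_division p" and fine: "\<gamma> fine (arctan_tagged ` p)"
    have inj_p: "inj_on arctan_tagged p" by (rule inj_on_subset[OF inj_arctan_tagged subset_UNIV])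
    have termwise: "norm (ext_content K *\<^sub>R ext_extend f x - content (arctan_vec ` K) *\<^sub>R pullback f (arctan_vec x))
        \<le> content (arctan_vec ` K) * (e / (1 + ?C))" if xK: "(x, K) \<in> p" for x K
    proof (cases "arctan_vec x \<in> open_angle_cube")
      case False
      then have "ext_extend f x = 0" "pullback f (arctan_vec x) = 0"
        using tan_jacobian_boundary[of "arctan_vec x"] arctan_vec_in_cube[of x]
        by (simp_all only: ext_extend_def pullback_def finite_iff_arctan_vec Diff_iff scaleR_zero_left if_False simp_thms)
      then show ?thesis using \<open>e > 0\<close> C by simp
    next
      case True
      obtain a b where ab: "x \<in> K" "K = {a..b}"
        using p xK unfolding ext_tagged_division_def by metis
      let ?u = "arctan_vec x" and ?L = "arctan_vec ` K"
      have "(?u, ?L) \<in> arctan_tagged ` p"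
        using xK by (force simp: arctan_tagged_def)
      from fineD[OF fine this] True have "?L \<subseteq> ball ?u (r ?u)"
        unfolding \<gamma>_def by (simp only: if_True)
      then have *: "\<bar>ext_content K - content ?L * tan_jacobian ?u\<bar> \<le> \<eta> ?u * content ?L"
        using r(2)[OF True] ab by auto
      have fin: "\<And>j. \<bar>x $ j\<bar> \<noteq> \<infinity>" by (rule finite_iff_arctan_vec[THEN iffD2, OF True, rule_format])
      have "(\<chi> j. real_of_ereal (x $ j)) = (\<chi> j. tan (?u $ j))"
      proof -
        have "real_of_ereal (x $ j) = tan (?u $ j)" for j
          using fin[of j] by (cases "x $ j") (auto simp: arctan_vec_def tan_arctan)
        then show ?thesis by simp
      qed
      then have ext: "ext_extend f x = ?t ?u"
        using fin by (simp add: ext_extend_def)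
      have "norm (ext_content K *\<^sub>R ext_extend f x - content ?L *\<^sub>R pullback f ?u)
          = \<bar>ext_content K - content ?L * tan_jacobian ?u\<bar> * norm (?t ?u)"
        by (simp add: ext pullback_def flip: scaleR_left_diff_distrib)
      also have "\<dots> \<le> \<eta> ?u * content ?L * (1 + norm (?t ?u))"
        using * by (intro mult_mono) auto
      also have "\<dots> = content ?L * (e / (1 + ?C))"
      proof -
        have "1 + norm (?t ?u) \<noteq> 0" by (smt (verit) norm_ge_zero)
        then show ?thesis unfolding \<eta>_def by simp
      qed
      finally show ?thesis .
    qed
    have "(\<Sum>(u, K)\<in>arctan_tagged ` p. content K *\<^sub>R pullback f u)
        = (\<Sum>(x, K)\<in>p. content (arctan_vec ` K) *\<^sub>R pullback f (arctan_vec x))"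
      by (subst sum.reindex[OF inj_p]) (simp add: arctan_tagged_def case_prod_unfold)
    then have "norm ((\<Sum>(x, K)\<in>p. ext_content K *\<^sub>R ext_extend f x)
           - (\<Sum>(u, K)\<in>arctan_tagged ` p. content K *\<^sub>R pullback f u))
        = norm (\<Sum>(x, K)\<in>p. ext_content K *\<^sub>R ext_extend f x - content (arctan_vec ` K) *\<^sub>R pullback f (arctan_vec x))"
      by (simp add: sum_subtractf case_prod_unfold)
    also have "\<dots> \<le> (\<Sum>(x, K)\<in>p. content (arctan_vec ` K) * (e / (1 + ?C)))"
      by (rule order_trans[OF norm_sum sum_mono]) (use termwise in auto)
    also have "\<dots> = (\<Sum>(u, K)\<in>arctan_tagged ` p. content K * (e / (1 + ?C)))"
      by (subst sum.reindex[OF inj_p]) (simp add: arctan_tagged_def case_prod_unfold)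
    also have "\<dots> = (\<Sum>(u, K)\<in>arctan_tagged ` p. content K) * (e / (1 + ?C))"
      by (simp only: sum_distrib_right case_prod_unfold)
    also have "\<dots> = ?C * (e / (1 + ?C))"
      using additive_content_tagged_division[OF arctan_tagged_division[OF p]] by simp
    also have "\<dots> \<le> e"
    proof -
      have "0 < 1 + ?C" using C by linarith
      then show ?thesis using \<open>e > 0\<close> by (simp only: times_divide_eq_right pos_divide_le_eq) (simp add: algebra_simps)
    qed
    finally show "norm ((\<Sum>(x, K)\<in>p. ext_content K *\<^sub>R ext_extend f x)
           - (\<Sum>(u, K)\<in>arctan_tagged ` p. content K *\<^sub>R pullback f u)) \<le> e" .
  qed
qed

text \<open>
  A gauge on one side is carried to the other by the homeomorphism, and intersected with the gauge of the
  comparison of Riemann sums. In particular the integral on the extended space inherits uniqueness.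
\<close>

theorem hk_has_integral_iff_pullback:
  fixes f :: "real ^ 'n \<Rightarrow> 'b::real_normed_vector"
  shows "hk_has_integral f I \<longleftrightarrow> (pullback f has_integral I) angle_cube"
proof
  assume f: "hk_has_integral f I"
  show "(pullback f has_integral I) angle_cube"
    unfolding has_integral
  proof (intro allI impI)
    fix e :: real assume "e > 0"
    then have e2: "e/2 > 0" by simp
    obtain \<gamma>1 where \<gamma>1: "gauge \<gamma>1" "\<forall>p. ext_tagged_division p \<and> \<gamma>1 fine p \<longrightarrow>
        norm ((\<Sum>(x, K)\<in>p. ext_content K *\<^sub>R ext_extend f x) - I) < e/2"
      using f[unfolded hk_has_integral_def, THEN spec, THEN mp, OF e2] by (elim exE conjE)
    obtain \<gamma>2 :: "real ^ 'n \<Rightarrow> (real ^ 'n) set" where \<gamma>2: "gauge \<gamma>2" "\<And>p. ext_tagged_division p \<Longrightarrow> \<gamma>2 fine (arctan_tagged ` p) \<Longrightarrow>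
       norm ((\<Sum>(x, K)\<in>p. ext_content K *\<^sub>R ext_extend f x)
           - (\<Sum>(u, K)\<in>arctan_tagged ` p. content K *\<^sub>R pullback f u)) \<le> e/2"
      by (rule riemann_sum_approx[OF e2, of f]) (rule that)
    have "\<exists>T. open T \<and> T \<inter> angle_cube = tan_vec -` \<gamma>1 (tan_vec u) \<inter> angle_cube" for u
    proof -
      have "open (\<gamma>1 (tan_vec u))" using \<gamma>1(1) by (simp add: gauge_def)
      with continuous_on_tan_vec show ?thesis unfolding continuous_on_open_invariant by blast
    qed
    then have "\<exists>T. \<forall>u. open (T u) \<and> T u \<inter> angle_cube = tan_vec -` \<gamma>1 (tan_vec u) \<inter> angle_cube"
      by (rule choice[OF allI])
    then obtain T where T: "\<And>u. open (T u)" "\<And>u. T u \<inter> angle_cube = tan_vec -` \<gamma>1 (tan_vec u) \<inter> angle_cube"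
      by blast
    define \<gamma>3 where "\<gamma>3 u = (if u \<in> angle_cube then T u else UNIV)" for u
    have "u \<in> \<gamma>3 u" for u
    proof (cases "u \<in> angle_cube")
      case True
      have "tan_vec u \<in> \<gamma>1 (tan_vec u)" using \<gamma>1(1) by (simp add: gauge_def)
      with True T(2)[of u] show ?thesis unfolding \<gamma>3_def by (metis (no_types, lifting) IntD1 IntI vimageI)
    qed (simp add: \<gamma>3_def)
    then have \<gamma>3: "gauge \<gamma>3" using T(1) by (auto simp: gauge_def \<gamma>3_def)
    show "\<exists>\<gamma>. gauge \<gamma> \<and> (\<forall>\<D>. \<D> tagged_division_of angle_cube \<and> \<gamma> fine \<D> \<longrightarrow>
        norm ((\<Sum>(x, k)\<in>\<D>. content k *\<^sub>R pullback f x) - I) < e)"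
    proof (intro exI[of _ "\<lambda>u. \<gamma>2 u \<inter> \<gamma>3 u"] conjI allI impI)
      show "gauge (\<lambda>u. \<gamma>2 u \<inter> \<gamma>3 u)" using \<gamma>2(1) \<gamma>3 by (rule gauge_Int)
      fix q assume q: "q tagged_division_of angle_cube \<and> (\<lambda>u. \<gamma>2 u \<inter> \<gamma>3 u) fine q"
      obtain p where p: "ext_tagged_division p" "arctan_tagged ` p = q"
        by (rule tagged_division_of_angle_cubeE[OF conjunct1[OF q]]) (rule that)
      have fine1: "\<gamma>1 fine p"
      proof (rule fineI)
        fix x K assume "(x, K) \<in> p"
        then have "(arctan_vec x, arctan_vec ` K) \<in> q"
          using p(2) by (force simp: arctan_tagged_def)
        then have "arctan_vec ` K \<subseteq> \<gamma>3 (arctan_vec x)" using q unfolding fine_def by blast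
        then have "arctan_vec ` K \<subseteq> T (arctan_vec x) \<inter> angle_cube"
          using arctan_vec_in_cube unfolding \<gamma>3_def if_P[OF arctan_vec_in_cube] by blast
        then have sub: "arctan_vec ` K \<subseteq> tan_vec -` \<gamma>1 (tan_vec (arctan_vec x))" unfolding T(2) by blast
        show "K \<subseteq> \<gamma>1 x"
        proof
          fix t assume "t \<in> K"
          then have "arctan_vec t \<in> tan_vec -` \<gamma>1 (tan_vec (arctan_vec x))" using sub by blast
          then show "t \<in> \<gamma>1 x" by (simp only: vimage_eq tan_vec_arctan_vec)
        qed
      qed
      have *: "norm ((\<Sum>(x, K)\<in>p. ext_content K *\<^sub>R ext_extend f x) - I) < e/2"
        by (intro \<gamma>1(2)[THEN spec, THEN mp] conjI p(1) fine1)
      have "\<gamma>2 fine q" using q by (simp add: fine_Int)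
      then have "norm ((\<Sum>(x, K)\<in>p. ext_content K *\<^sub>R ext_extend f x)
           - (\<Sum>(u, K)\<in>q. content K *\<^sub>R pullback f u)) \<le> e/2"
        by (rule \<gamma>2(2)[OF p(1), unfolded p(2)])
      then have "norm ((\<Sum>(u, K)\<in>q. content K *\<^sub>R pullback f u)
          - (\<Sum>(x, K)\<in>p. ext_content K *\<^sub>R ext_extend f x)) \<le> e/2"
        by (simp only: norm_minus_commute)
      then show "norm ((\<Sum>(x, k)\<in>q. content k *\<^sub>R pullback f x) - I) < e"
        using * by (rule norm_diff_less_halves)
    qed
  qed
next
  assume f: "(pullback f has_integral I) angle_cube"
  show "hk_has_integral f I"
    unfolding hk_has_integral_def
  proof (intro allI impI)
    fix e :: real assume "e > 0"
    then have e2: "e/2 > 0" by simp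
    obtain \<gamma>1 where \<gamma>1: "gauge \<gamma>1" "\<forall>q. q tagged_division_of angle_cube \<and> \<gamma>1 fine q \<longrightarrow>
        norm ((\<Sum>(u, K)\<in>q. content K *\<^sub>R pullback f u) - I) < e/2"
      using f[unfolded has_integral, THEN spec, THEN mp, OF e2] by (elim exE conjE)
    obtain \<gamma>2 :: "real ^ 'n \<Rightarrow> (real ^ 'n) set" where \<gamma>2: "gauge \<gamma>2" "\<And>p. ext_tagged_division p \<Longrightarrow> \<gamma>2 fine (arctan_tagged ` p) \<Longrightarrow>
       norm ((\<Sum>(x, K)\<in>p. ext_content K *\<^sub>R ext_extend f x)
           - (\<Sum>(u, K)\<in>arctan_tagged ` p. content K *\<^sub>R pullback f u)) \<le> e/2"
      by (rule riemann_sum_approx[OF e2, of f]) (rule that)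
    let ?\<gamma> = "\<lambda>x. arctan_vec -` (\<gamma>1 (arctan_vec x) \<inter> \<gamma>2 (arctan_vec x))"
    show "\<exists>\<gamma>. gauge \<gamma> \<and> (\<forall>p. ext_tagged_division p \<and> \<gamma> fine p \<longrightarrow>
        norm ((\<Sum>(x, K)\<in>p. ext_content K *\<^sub>R ext_extend f x) - I) < e)"
    proof (intro exI[of _ ?\<gamma>] conjI allI impI)
      show "gauge ?\<gamma>"
        using \<gamma>1(1) \<gamma>2(1) unfolding gauge_def
        by (intro allI conjI open_vimage[OF _ continuous_on_arctan_vec] open_Int) simp_all
      fix p assume p: "ext_tagged_division p \<and> ?\<gamma> fine p"
      then have "(\<lambda>u. \<gamma>1 u \<inter> \<gamma>2 u) fine (arctan_tagged ` p)"
        unfolding fine_def arctan_tagged_def by force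
      then have fine: "\<gamma>1 fine (arctan_tagged ` p)" "\<gamma>2 fine (arctan_tagged ` p)"
        by (auto simp: fine_Int)
      have "norm ((\<Sum>(u, K)\<in>arctan_tagged ` p. content K *\<^sub>R pullback f u) - I) < e/2"
        by (intro \<gamma>1(2)[THEN spec, THEN mp] conjI fine(1) arctan_tagged_division conjunct1[OF p])
      moreover have "norm ((\<Sum>(x, K)\<in>p. ext_content K *\<^sub>R ext_extend f x)
           - (\<Sum>(u, K)\<in>arctan_tagged ` p. content K *\<^sub>R pullback f u)) \<le> e/2"
        by (intro \<gamma>2(2) conjunct1[OF p] fine(2))
      ultimately show "norm ((\<Sum>(x, K)\<in>p. ext_content K *\<^sub>R ext_extend f x) - I) < e"
        by (rule norm_diff_less_halves[rotated])
    qed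
  qed
qed

corollary hk_integrable_iff_pullback:
  "hk_integrable f \<longleftrightarrow> pullback f integrable_on angle_cube"
  by (simp add: hk_integrable_def integrable_on_def hk_has_integral_iff_pullback)

corollary hk_integral_eq_pullback:
  assumes "pullback f integrable_on angle_cube"
  shows "hk_integral f = integral angle_cube (pullback f)"
  unfolding hk_integral_def
proof (rule the_equality)
  show "hk_has_integral f (integral angle_cube (pullback f))"
    using assms by (simp only: hk_has_integral_iff_pullback has_integral_integral[symmetric])
  show "I = integral angle_cube (pullback f)" if "hk_has_integral f I" for I
    using that unfolding hk_has_integral_iff_pullback by (rule integral_unique[symmetric])
qed

section \<open>Equiintegrable families and multipliers\<close>

text \<open>
  The error of a Riemann sum is linear in the integrand. So a gauge that is good for the family is good,
  with the error multiplied by \<open>K\<close>, for all combinations whose coefficients have absolute sum at most \<open>K\<close>.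
\<close>

lemma equiintegrable_combinations:
  fixes F :: "('a::euclidean_space \<Rightarrow> complex) set"
  assumes F: "F equiintegrable_on cbox a b" and "0 \<le> K"
  shows "{\<lambda>x. \<Sum>i\<in>I. c i * g i x | (I :: 'i set) c g.
            finite I \<and> (\<forall>i\<in>I. g i \<in> F) \<and> (\<Sum>i\<in>I. cmod (c i)) \<le> K} equiintegrable_on cbox a b"
  unfolding equiintegrable_on_def
proof (intro conjI ballI allI impI)
  have int: "(\<lambda>x. \<Sum>i\<in>I. c i * g i x) integrable_on cbox a b"
    and eq: "integral (cbox a b) (\<lambda>x. \<Sum>i\<in>I. c i * g i x) = (\<Sum>i\<in>I. c i * integral (cbox a b) (g i))"
    if "finite I" "\<forall>i\<in>I. g i \<in> F" for I :: "'i set" and c g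
  proof -
    have *: "(\<lambda>x. c i * g i x) integrable_on cbox a b" if "i \<in> I" for i
      using that \<open>\<forall>i\<in>I. g i \<in> F\<close> equiintegrable_on_integrable[OF F] by (intro integrable_on_mult_right) auto
    show "(\<lambda>x. \<Sum>i\<in>I. c i * g i x) integrable_on cbox a b"
      using \<open>finite I\<close> * by (rule integrable_sum)
    show "integral (cbox a b) (\<lambda>x. \<Sum>i\<in>I. c i * g i x) = (\<Sum>i\<in>I. c i * integral (cbox a b) (g i))"
      using \<open>finite I\<close> * by (subst integral_sum) simp_all
  qed
  {
    fix h
    assume "h \<in> {\<lambda>x. \<Sum>i\<in>I. c i * g i x | (I :: 'i set) c g.
            finite I \<and> (\<forall>i\<in>I. g i \<in> F) \<and> (\<Sum>i\<in>I. cmod (c i)) \<le> K}"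
    then obtain I :: "'i set" and c g where "h = (\<lambda>x. \<Sum>i\<in>I. c i * g i x)" "finite I" "\<forall>i\<in>I. g i \<in> F"
      by blast
    then show "h integrable_on cbox a b" using int by simp
  }
  fix e :: real assume "e > 0"
  have "e / (K + 1) > 0" using \<open>e > 0\<close> \<open>0 \<le> K\<close> by simp
  note F[unfolded equiintegrable_on_def, THEN conjunct2, THEN spec, THEN mp, OF this]
  then obtain \<gamma> where \<gamma>: "gauge \<gamma>" "\<forall>g \<D>. g \<in> F \<and> \<D> tagged_division_of cbox a b \<and> \<gamma> fine \<D> \<longrightarrow>
      norm ((\<Sum>(x, k)\<in>\<D>. content k *\<^sub>R g x) - integral (cbox a b) g) < e / (K + 1)"
    by (elim exE conjE)
  show "\<exists>\<gamma>. gauge \<gamma> \<and> (\<forall>h \<D>. h \<in> {\<lambda>x. \<Sum>i\<in>I. c i * g i x | (I :: 'i set) c g.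
            finite I \<and> (\<forall>i\<in>I. g i \<in> F) \<and> (\<Sum>i\<in>I. cmod (c i)) \<le> K} \<and>
          \<D> tagged_division_of cbox a b \<and> \<gamma> fine \<D> \<longrightarrow>
          norm ((\<Sum>(x, K)\<in>\<D>. content K *\<^sub>R h x) - integral (cbox a b) h) < e)"
  proof (intro exI[of _ \<gamma>] conjI allI impI \<gamma>(1))
    fix h \<D>
    assume *: "h \<in> {\<lambda>x. \<Sum>i\<in>I. c i * g i x | (I :: 'i set) c g.
            finite I \<and> (\<forall>i\<in>I. g i \<in> F) \<and> (\<Sum>i\<in>I. cmod (c i)) \<le> K} \<and>
          \<D> tagged_division_of cbox a b \<and> \<gamma> fine \<D>"
    then obtain I :: "'i set" and c g where h: "h = (\<lambda>x. \<Sum>i\<in>I. c i * g i x)" "finite I"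
      "\<forall>i\<in>I. g i \<in> F" "(\<Sum>i\<in>I. cmod (c i)) \<le> K" by blast
    let ?err = "\<lambda>g. (\<Sum>(x, k)\<in>\<D>. content k *\<^sub>R g x) - integral (cbox a b) g"
    have "(\<Sum>(x, k)\<in>\<D>. content k *\<^sub>R h x) = (\<Sum>i\<in>I. c i * (\<Sum>(x, k)\<in>\<D>. content k *\<^sub>R g i x))"
      unfolding h(1) case_prod_unfold
      by (simp add: scaleR_sum_right sum_distrib_left sum.swap[of _ \<D> I] mult_scaleR_right)
    then have "?err h = (\<Sum>i\<in>I. c i * ?err (g i))"
      unfolding h(1) using eq[OF h(2,3)] by (simp add: right_diff_distrib sum_subtractf)
    then have "norm (?err h) \<le> (\<Sum>i\<in>I. cmod (c i) * norm (?err (g i)))"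
      using norm_sum[of "\<lambda>i. c i * ?err (g i)" I] by (simp only: norm_mult)
    also have "\<dots> \<le> (\<Sum>i\<in>I. cmod (c i) * (e / (K + 1)))"
    proof (intro sum_mono mult_left_mono norm_ge_zero)
      fix i assume "i \<in> I"
      then have "g i \<in> F" using h(3) by blast
      moreover have "\<D> tagged_division_of cbox a b" "\<gamma> fine \<D>" using * by blast+
      ultimately have "norm (?err (g i)) < e / (K + 1)"
        by (intro \<gamma>(2)[THEN spec, THEN spec, THEN mp] conjI)
      then show "norm (?err (g i)) \<le> e / (K + 1)" by (rule less_imp_le)
    qed
    also have "\<dots> \<le> K * (e / (K + 1))"
      unfolding sum_distrib_right[symmetric] using h(4) \<open>e / (K + 1) > 0\<close> by (intro mult_right_mono) auto
    also have "\<dots> < e" using \<open>e > 0\<close> \<open>0 \<le> K\<close> by (simp add: field_simps)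
    finally show "norm (?err h) < e" .
  qed
qed

text \<open>
  A fixed Riemann sum involves finitely many values, hence passes to pointwise limits, and by the limit theorem
  for equiintegrable sequences so do the integrals.
\<close>

lemma equiintegrable_pointwise_limits:
  fixes F :: "('a::euclidean_space \<Rightarrow> 'b::banach) set"
  assumes F: "F equiintegrable_on cbox a b"
  shows "{h. \<exists>f. range f \<subseteq> F \<and> (\<forall>x\<in>cbox a b. (\<lambda>n::nat. f n x) \<longlonglongrightarrow> h x)} equiintegrable_on cbox a b"
  unfolding equiintegrable_on_def
proof (intro conjI ballI allI impI)
  fix h
  assume "h \<in> {h. \<exists>f. range f \<subseteq> F \<and> (\<forall>x\<in>cbox a b. (\<lambda>n::nat. f n x) \<longlonglongrightarrow> h x)}"
  then obtain f where f: "range f \<subseteq> F" "\<forall>x\<in>cbox a b. (\<lambda>n::nat. f n x) \<longlonglongrightarrow> h x"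
    by (elim CollectE exE conjE)
  show "h integrable_on cbox a b"
    by (rule equiintegrable_limit[OF equiintegrable_on_subset[OF F f(1)] f(2)[THEN bspec], THEN conjunct1])
next
  fix e :: real assume "e > 0"
  then have "e / 2 > 0" by simp
  note F[unfolded equiintegrable_on_def, THEN conjunct2, THEN spec, THEN mp, OF this]
  then obtain \<gamma> where \<gamma>: "gauge \<gamma>" "\<forall>g \<D>. g \<in> F \<and> \<D> tagged_division_of cbox a b \<and> \<gamma> fine \<D> \<longrightarrow>
      norm ((\<Sum>(x, k)\<in>\<D>. content k *\<^sub>R g x) - integral (cbox a b) g) < e / 2"
    by (elim exE conjE)
  show "\<exists>\<gamma>. gauge \<gamma> \<and> (\<forall>h \<D>. h \<in> {h. \<exists>f. range f \<subseteq> F \<and> (\<forall>x\<in>cbox a b. (\<lambda>n::nat. f n x) \<longlonglongrightarrow> h x)} \<and>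
          \<D> tagged_division_of cbox a b \<and> \<gamma> fine \<D> \<longrightarrow>
          norm ((\<Sum>(x, K)\<in>\<D>. content K *\<^sub>R h x) - integral (cbox a b) h) < e)"
  proof (intro exI[of _ \<gamma>] conjI allI impI \<gamma>(1))
    fix h \<D>
    assume *: "h \<in> {h. \<exists>f. range f \<subseteq> F \<and> (\<forall>x\<in>cbox a b. (\<lambda>n::nat. f n x) \<longlonglongrightarrow> h x)} \<and>
          \<D> tagged_division_of cbox a b \<and> \<gamma> fine \<D>"
    from CollectD[OF conjunct1[OF *]] obtain f where f: "range f \<subseteq> F" "\<forall>x\<in>cbox a b. (\<lambda>n::nat. f n x) \<longlonglongrightarrow> h x"
      by (elim exE conjE)
    have D: "\<D> tagged_division_of cbox a b" "\<gamma> fine \<D>" using * by blast+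
    have "(\<lambda>n. integral (cbox a b) (f n)) \<longlonglongrightarrow> integral (cbox a b) h"
      by (rule equiintegrable_limit[OF equiintegrable_on_subset[OF F f(1)] f(2)[THEN bspec], THEN conjunct2])
    moreover have "(\<lambda>n. \<Sum>(x, k)\<in>\<D>. content k *\<^sub>R f n x) \<longlonglongrightarrow> (\<Sum>(x, k)\<in>\<D>. content k *\<^sub>R h x)"
    proof -
      have "x \<in> cbox a b" if "(x, k) \<in> \<D>" for x k
        using D(1) that unfolding tagged_division_of by blast
      then show ?thesis unfolding case_prod_unfold
        by (intro tendsto_intros f(2)[THEN bspec]) auto
    qed
    ultimately have "(\<lambda>n. norm ((\<Sum>(x, k)\<in>\<D>. content k *\<^sub>R f n x) - integral (cbox a b) (f n)))
        \<longlonglongrightarrow> norm ((\<Sum>(x, k)\<in>\<D>. content k *\<^sub>R h x) - integral (cbox a b) h)"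
      by (intro tendsto_norm tendsto_diff)
    moreover have "norm ((\<Sum>(x, k)\<in>\<D>. content k *\<^sub>R f n x) - integral (cbox a b) (f n)) \<le> e / 2" for n
      using f(1) by (intro less_imp_le \<gamma>(2)[THEN spec, THEN spec, THEN mp] D conjI) blast
    ultimately have "norm ((\<Sum>(x, k)\<in>\<D>. content k *\<^sub>R h x) - integral (cbox a b) h) \<le> e / 2"
      by (intro LIMSEQ_le_const2) blast+
    then show "norm ((\<Sum>(x, K)\<in>\<D>. content K *\<^sub>R h x) - integral (cbox a b) h) < e"
      using \<open>e > 0\<close> by linarith
  qed
qed

definition partition_point :: "real \<Rightarrow> real \<Rightarrow> nat \<Rightarrow> nat \<Rightarrow> real" where
  "partition_point \<alpha> \<beta> r s = \<alpha> + real s / real r * (\<beta> - \<alpha>)"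

lemma partition_point_mono: "\<alpha> \<le> \<beta> \<Longrightarrow> s \<le> t \<Longrightarrow> partition_point \<alpha> \<beta> r s \<le> partition_point \<alpha> \<beta> r t"
  unfolding partition_point_def by (intro add_left_mono mult_right_mono divide_right_mono) auto

lemma partition_point_ends:
  "partition_point \<alpha> \<beta> r 0 = \<alpha>" "0 < r \<Longrightarrow> partition_point \<alpha> \<beta> r r = \<beta>"
  unfolding partition_point_def by auto

text \<open>
  The step function that follows \<open>\<theta>\<close> at the partition points is written by partial summation as a
  combination of indicators of half lines. The coefficients are the increments of \<open>\<theta>\<close>, so their
  absolute sum is bounded by the variation.
\<close>

lemma step_function_eq:
  fixes \<theta> :: "real \<Rightarrow> complex"
  assumes "\<alpha> \<le> x" "x \<le> \<beta>" "0 < r"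
  defines "p \<equiv> partition_point \<alpha> \<beta> r"
  shows "\<exists>k. k \<le> r \<and> p k \<le> x \<and> x - p k \<le> (\<beta> - \<alpha>) / r \<and>
    \<theta> \<alpha> + (\<Sum>s<r. (\<theta> (p (Suc s)) - \<theta> (p s)) * (if p (Suc s) \<le> x then 1 else 0)) = \<theta> (p k)"
proof -
  have "\<alpha> \<le> \<beta>" using assms by simp
  have ends: "p 0 = \<alpha>" "p r = \<beta>"
    unfolding p_def using \<open>0 < r\<close> by (simp_all add: partition_point_ends)
  define A where "A = {s. s \<le> r \<and> p s \<le> x}"
  have "finite A" "0 \<in> A" using ends assms by (auto simp: A_def)
  define k where "k = Max A"
  have k: "k \<in> A" unfolding k_def using \<open>finite A\<close> \<open>0 \<in> A\<close> by (intro Max_in) auto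
  have iff: "p s \<le> x \<longleftrightarrow> s \<le> k" if "s \<le> r" for s
  proof
    assume "p s \<le> x" then show "s \<le> k" unfolding k_def using \<open>finite A\<close> that by (intro Max_ge) (auto simp: A_def)
  next
    assume "s \<le> k"
    then have "p s \<le> p k" unfolding p_def by (rule partition_point_mono[OF \<open>\<alpha> \<le> \<beta>\<close>])
    then show "p s \<le> x" using k by (simp add: A_def)
  qed
  show ?thesis
  proof (intro exI conjI)
    show "k \<le> r" "p k \<le> x" using k by (auto simp: A_def)
    show "x - p k \<le> (\<beta> - \<alpha>) / r"
    proof (cases "k = r")
      case True
      have "0 \<le> (\<beta> - \<alpha>) / real r" using \<open>\<alpha> \<le> \<beta>\<close> by simp
      then show ?thesis using True ends assms(2) by simp
    next
      case False
      then have "\<not> p (Suc k) \<le> x" using iff[of "Suc k"] \<open>k \<le> r\<close> by simp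
      moreover have "p (Suc k) = p k + (\<beta> - \<alpha>) / r"
        unfolding p_def partition_point_def by (simp add: add_divide_distrib diff_divide_distrib algebra_simps)
      ultimately show ?thesis by simp
    qed
    have "(\<Sum>s<r. (\<theta> (p (Suc s)) - \<theta> (p s)) * (if p (Suc s) \<le> x then 1 else 0))
        = (\<Sum>s<k. \<theta> (p (Suc s)) - \<theta> (p s))"
      using \<open>k \<le> r\<close> by (intro sum.mono_neutral_cong_right) (auto simp: iff)
    also have "\<dots> = \<theta> (p k) - \<theta> \<alpha>"
      unfolding sum_lessThan_telescope[of "\<lambda>s. \<theta> (p s)"] by (simp add: ends)
    finally show "\<theta> \<alpha> + (\<Sum>s<r. (\<theta> (p (Suc s)) - \<theta> (p s)) * (if p (Suc s) \<le> x then 1 else 0)) = \<theta> (p k)"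
      by simp
  qed
qed

text \<open>
  The function \<open>V\<close> majorizes the variation of \<open>\<theta>\<close> on the side \<open>[c_j, d_j]\<close> of the box. Cutting the box by
  half spaces \<open>p \<le> u_j\<close> yields boxes again, so by the partial summation above the product with
  \<open>\<theta>(u_j)\<close> on a box is a limit of combinations of box restrictions with absolute coefficient sum at most
  \<open>K\<close>. The point is that \<open>K\<close> bounds the whole family, while box, coordinate and \<open>\<theta>\<close> vary.
\<close>

lemma equiintegrable_coordinate_multipliers:
  fixes F :: "real ^ 'n \<Rightarrow> complex"
  assumes F: "F integrable_on cbox a b" and "0 \<le> K"
  shows "{\<lambda>u. if u \<in> cbox c d then \<theta> (u $ j) * F u else 0 | c d \<theta> j.
           continuous_on {c $ j..d $ j} \<theta> \<and>
           (\<exists>V. (\<forall>s t. c $ j \<le> s \<longrightarrow> s \<le> t \<longrightarrow> t \<le> d $ j \<longrightarrow> cmod (\<theta> t - \<theta> s) \<le> V t - V s) \<and>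
                cmod (\<theta> (c $ j)) + (V (d $ j) - V (c $ j)) \<le> K)} equiintegrable_on cbox a b"
    (is "?M equiintegrable_on _")
proof -
  define B where "B = (\<Union>c d. {\<lambda>u. if u \<in> cbox c d then F u else 0})"
  define C where "C = {\<lambda>x. \<Sum>i\<in>I. c i * g i x | (I :: nat set) c g.
            finite I \<and> (\<forall>i\<in>I. g i \<in> B) \<and> (\<Sum>i\<in>I. cmod (c i)) \<le> K}"
  have "B equiintegrable_on cbox a b"
    unfolding B_def by (rule equiintegrable_closed_interval_restrictions[OF F])
  then have "C equiintegrable_on cbox a b"
    unfolding C_def using \<open>0 \<le> K\<close> by (rule equiintegrable_combinations)
  then have lim: "{h. \<exists>f. range f \<subseteq> C \<and> (\<forall>x\<in>cbox a b. (\<lambda>n::nat. f n x) \<longlonglongrightarrow> h x)} equiintegrable_on cbox a b"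
    by (rule equiintegrable_pointwise_limits)
  show ?thesis
  proof (rule equiintegrable_on_subset[OF lim], rule subsetI)
    fix h assume "h \<in> ?M"
    then obtain c d \<theta> j V where h: "h = (\<lambda>u. if u \<in> cbox c d then \<theta> (u $ j) * F u else 0)"
      and cont: "continuous_on {c $ j..d $ j} \<theta>"
      and V: "\<And>s t. c $ j \<le> s \<Longrightarrow> s \<le> t \<Longrightarrow> t \<le> d $ j \<Longrightarrow> cmod (\<theta> t - \<theta> s) \<le> V t - V s"
      and K: "cmod (\<theta> (c $ j)) + (V (d $ j) - V (c $ j)) \<le> K"
      by blast
    show "h \<in> {h. \<exists>f. range f \<subseteq> C \<and> (\<forall>x\<in>cbox a b. (\<lambda>n::nat. f n x) \<longlonglongrightarrow> h x)}"
    proof (cases "c $ j \<le> d $ j")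
      case False
      then have "cbox c d = {}"
        by (auto simp: mem_box_cart) (meson order_trans)
      then have "h = (\<lambda>u. 0)" using h by auto
      moreover have "(\<lambda>u. 0) \<in> C"
        unfolding C_def by (intro CollectI exI[of _ "{}"]) (use \<open>0 \<le> K\<close> in auto)
      ultimately show ?thesis by (intro CollectI exI[of _ "\<lambda>n. h"]) auto
    next
      case True
      let ?\<alpha> = "c $ j" and ?\<beta> = "d $ j"
      define p where "p n = partition_point ?\<alpha> ?\<beta> (Suc n)" for n
      have ends: "p n 0 = ?\<alpha>" "p n (Suc n) = ?\<beta>" for n
        unfolding p_def by (simp_all add: partition_point_ends)
      have p_mono: "s \<le> t \<Longrightarrow> p n s \<le> p n t" for n s t
        unfolding p_def by (rule partition_point_mono[OF True])
      \<comment> \<open>Index 0 carries the initial value on the whole box, index \<open>s + 1\<close> the increment of \<open>\<theta>\<close> on the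
        part of the box above the partition point \<open>s + 1\<close>.\<close>
      define co where "co n i = (case i of 0 \<Rightarrow> \<theta> ?\<alpha> | Suc s \<Rightarrow> \<theta> (p n (Suc s)) - \<theta> (p n s))" for n i
      define g where "g n i = (\<lambda>u. if u \<in> cbox (\<chi> k. if k = j then p n i else c $ k) d then F u else 0)" for n i
      define f where "f n u = (\<Sum>i<Suc (Suc n). co n i * g n i u)" for n u
      have box: "u \<in> cbox (\<chi> k. if k = j then p n i else c $ k) d \<longleftrightarrow> u \<in> cbox c d \<and> p n i \<le> u $ j" for u n i
      proof -
        have "?\<alpha> \<le> p n i" using p_mono[of 0 i n] by (simp add: ends)
        then show ?thesis by (auto simp: mem_box_cart split: if_splits intro: order_trans)
      qed
      have f_eq: "f n u = (if u \<in> cbox c d then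
          (\<theta> ?\<alpha> + (\<Sum>s<Suc n. (\<theta> (p n (Suc s)) - \<theta> (p n s)) * (if p n (Suc s) \<le> u $ j then 1 else 0))) * F u else 0)" for n u
      proof (cases "u \<in> cbox c d")
        case u: True
        then have "?\<alpha> \<le> u $ j" by (simp add: mem_box_cart)
        then show ?thesis
          unfolding f_def sum.lessThan_Suc_shift[of _ "Suc n"] co_def g_def box distrib_right sum_distrib_right
          using u by (simp add: ends o_def if_distrib[of "\<lambda>x. _ * x"] if_distrib[of "\<lambda>x. x * _"] cong: if_cong)
      next
        case False
        then show ?thesis unfolding f_def g_def box by simp
      qed
      have "f n \<in> C" for n
        unfolding C_def
      proof (intro CollectI exI conjI)
        show "f n = (\<lambda>x. \<Sum>i\<in>{..<Suc (Suc n)}. co n i * g n i x)" by (simp add: f_def fun_eq_iff)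
        show "finite {..<Suc (Suc n)}" by simp
        show "\<forall>i\<in>{..<Suc (Suc n)}. g n i \<in> B" unfolding B_def g_def by blast
        have "(\<Sum>i<Suc (Suc n). cmod (co n i)) = cmod (\<theta> ?\<alpha>) + (\<Sum>s<Suc n. cmod (\<theta> (p n (Suc s)) - \<theta> (p n s)))"
          unfolding sum.lessThan_Suc_shift[of _ "Suc n"] by (simp add: co_def o_def)
        also have "\<dots> \<le> cmod (\<theta> ?\<alpha>) + (\<Sum>s<Suc n. V (p n (Suc s)) - V (p n s))"
        proof (intro add_left_mono sum_mono V)
          fix s assume "s \<in> {..<Suc n}"
          then show "?\<alpha> \<le> p n s" "p n s \<le> p n (Suc s)" "p n (Suc s) \<le> ?\<beta>"
            using p_mono[of 0 s n] p_mono[of s "Suc s" n] p_mono[of "Suc s" "Suc n" n] by (simp_all add: ends)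
        qed
        also have "\<dots> \<le> K"
          unfolding sum_lessThan_telescope[of "\<lambda>s. V (p n s)"] using K by (simp add: ends)
        finally show "(\<Sum>i<Suc (Suc n). cmod (co n i)) \<le> K" .
      qed
      moreover have "(\<lambda>n. f n u) \<longlonglongrightarrow> h u" for u
      proof (cases "u \<in> cbox c d")
        case u: True
        let ?x = "u $ j"
        have x: "?\<alpha> \<le> ?x" "?x \<le> ?\<beta>" using u by (simp_all add: mem_box_cart)
        have "\<forall>n. \<exists>k. k \<le> Suc n \<and> p n k \<le> ?x \<and> ?x - p n k \<le> (?\<beta> - ?\<alpha>) / Suc n \<and>
            \<theta> ?\<alpha> + (\<Sum>s<Suc n. (\<theta> (p n (Suc s)) - \<theta> (p n s)) * (if p n (Suc s) \<le> ?x then 1 else 0)) = \<theta> (p n k)"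
          using step_function_eq[OF x zero_less_Suc, of _ \<theta>] unfolding p_def by (rule allI)
        from choice[OF this] obtain k where "\<forall>n. k n \<le> Suc n \<and> p n (k n) \<le> ?x \<and> ?x - p n (k n) \<le> (?\<beta> - ?\<alpha>) / Suc n \<and>
            \<theta> ?\<alpha> + (\<Sum>s<Suc n. (\<theta> (p n (Suc s)) - \<theta> (p n s)) * (if p n (Suc s) \<le> ?x then 1 else 0)) = \<theta> (p n (k n))"
          by (elim exE)
        then have k: "\<And>n. k n \<le> Suc n" "\<And>n. p n (k n) \<le> ?x" "\<And>n. ?x - p n (k n) \<le> (?\<beta> - ?\<alpha>) / Suc n"
            "\<And>n. \<theta> ?\<alpha> + (\<Sum>s<Suc n. (\<theta> (p n (Suc s)) - \<theta> (p n s)) * (if p n (Suc s) \<le> ?x then 1 else 0)) = \<theta> (p n (k n))"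
          by blast+
        have "(\<lambda>n. ?x - p n (k n)) \<longlonglongrightarrow> 0"
        proof (rule real_tendsto_sandwich)
          show "\<forall>\<^sub>F n in sequentially. 0 \<le> ?x - p n (k n)" using k(2) by simp
          show "\<forall>\<^sub>F n in sequentially. ?x - p n (k n) \<le> (?\<beta> - ?\<alpha>) / Suc n" using k(3) by simp
          show "(\<lambda>n. (?\<beta> - ?\<alpha>) / real (Suc n)) \<longlonglongrightarrow> 0"
            using LIMSEQ_Suc[OF lim_const_over_n[of "?\<beta> - ?\<alpha>"]] by simp
        qed simp
        then have "(\<lambda>n. ?x - (?x - p n (k n))) \<longlonglongrightarrow> ?x - 0"
          by (intro tendsto_intros)
        then have "(\<lambda>n. p n (k n)) \<longlonglongrightarrow> ?x" by simp
        moreover have "p n (k n) \<in> {?\<alpha>..?\<beta>}" for n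
          using p_mono[of 0 "k n" n] p_mono[OF k(1)[of n], of n] by (simp add: ends)
        ultimately have "(\<lambda>n. \<theta> (p n (k n))) \<longlonglongrightarrow> \<theta> ?x"
          using x by (intro continuous_on_tendsto_compose[OF cont]) auto
        then have "(\<lambda>n. \<theta> (p n (k n)) * F u) \<longlonglongrightarrow> \<theta> ?x * F u"
          by (intro tendsto_intros)
        then show ?thesis using u by (simp only: f_eq h k(4) if_True)
      next
        case False
        then show ?thesis by (simp add: f_eq h)
      qed
      ultimately show ?thesis
        by (intro CollectI exI[of _ f]) auto
    qed
  qed
qed

section \<open>Moments of Henstock--Kurzweil integrable functions\<close>

text \<open>
  A set of points with some coordinate in a countable set is a countable union of hyperplanes, and
  the arctangent maps it to such a set. Changing a function there does not change its integral.
\<close>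

lemma has_integral_pullback_off_grid:
  fixes f g :: "real ^ 'n \<Rightarrow> 'b::real_normed_vector"
  assumes "countable S" and eq: "\<And>x. (\<And>j. x $ j \<notin> S) \<Longrightarrow> f x = g x"
    and f: "(pullback f has_integral I) angle_cube"
  shows "(pullback g has_integral I) angle_cube"
proof (rule has_integral_spike[OF _ _ f])
  let ?N = "\<Union>((\<lambda>(j, s). {u :: real ^ 'n. u $ j = arctan s}) ` (UNIV \<times> S))"
  show "negligible ?N"
  proof (rule negligible_countable_Union)
    show "countable ((\<lambda>(j, s). {u :: real ^ 'n. u $ j = arctan s}) ` (UNIV \<times> S))"
      using \<open>countable S\<close> by (intro countable_image countable_SIGMA) (auto intro: countable_finite)
    fix T assume "T \<in> (\<lambda>(j, s). {u :: real ^ 'n. u $ j = arctan s}) ` (UNIV \<times> S)"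
    then obtain j s where "T = {u. u $ j = arctan s}" by auto
    moreover have "negligible {u :: real ^ 'n. u \<bullet> axis j 1 = arctan s}"
      by (rule negligible_standard_hyperplane) (simp add: axis_in_Basis_iff)
    ultimately show "negligible T" by (simp only: cart_eq_inner_axis)
  qed
  fix u :: "real ^ 'n" assume u: "u \<in> angle_cube - ?N"
  show "pullback g u = pullback f u"
  proof (cases "u \<in> open_angle_cube")
    case True
    have "tan (u $ j) \<notin> S" for j
    proof
      assume "tan (u $ j) \<in> S"
      moreover have "u $ j = arctan (tan (u $ j))"
        using True unfolding mem_box_cart vec_lambda_beta by (intro arctan_tan[symmetric]) blast+
      ultimately have "u \<in> ?N" by blast
      then show False using u by blast
    qed
    then have "f (\<chi> j. tan (u $ j)) = g (\<chi> j. tan (u $ j))" by (intro eq) simp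
    then show ?thesis by (simp only: pullback_def)
  next
    case False
    then have "tan_jacobian u = 0" using u by (intro tan_jacobian_boundary) blast
    then show ?thesis by (simp only: pullback_def scaleR_zero_left)
  qed
qed

lemma norm_exp_i_diff_le: "cmod (exp (\<i> * complex_of_real s) - exp (\<i> * complex_of_real t)) \<le> \<bar>s - t\<bar>"
proof -
  have "exp (\<i> * complex_of_real t) * exp (\<i> * complex_of_real (s - t)) = exp (\<i> * complex_of_real s)"
    unfolding exp_add[symmetric] by (simp only: distrib_left[symmetric] of_real_add[symmetric] add_diff_cancel_left' diff_add_cancel add.commute[of t])
  then have "exp (\<i> * complex_of_real s) - exp (\<i> * complex_of_real t)
      = exp (\<i> * complex_of_real t) * (exp (\<i> * complex_of_real (s - t)) - 1)"
    by (simp only: right_diff_distrib mult_1_right)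
  then have "cmod (exp (\<i> * complex_of_real s) - exp (\<i> * complex_of_real t)) = 2 * \<bar>sin ((s - t) / 2)\<bar>"
    by (simp only: norm_mult norm_exp_i_times dist_exp_i_1 mult_1)
  also have "\<dots> \<le> \<bar>s - t\<bar>"
    using abs_sin_x_le_abs_x[of "(s - t) / 2"] by simp
  finally show ?thesis .
qed

lemma equiintegrable_on_finite_Union:
  fixes F :: "'i \<Rightarrow> ('a::euclidean_space \<Rightarrow> 'b::real_normed_vector) set"
  assumes "finite A" "\<And>i. i \<in> A \<Longrightarrow> F i equiintegrable_on I"
  shows "(\<Union>i\<in>A. F i) equiintegrable_on I"
  using assms
proof (induction A rule: finite_induct)
  case empty
  have "\<exists>\<gamma> :: 'a \<Rightarrow> 'a set. gauge \<gamma>" by (rule exI[of gauge "\<lambda>x. ball x 1"]) (rule gauge_trivial)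
  then show ?case by (simp add: equiintegrable_on_def)
next
  case (insert i A)
  have "F i equiintegrable_on I" by (rule insert.prems) simp
  moreover have "(\<Union>i\<in>A. F i) equiintegrable_on I" by (rule insert.IH, rule insert.prems) simp
  ultimately have "(F i \<union> (\<Union>i\<in>A. F i)) equiintegrable_on I" by (rule equiintegrable_on_Un)
  then show ?case by (simp only: UN_insert)
qed

lemma sd_E_component:
  fixes q :: "nat \<Rightarrow> real ^ 'n"
  assumes "idx m = (k, i)"
  shows "sd_E q idx m x $ j =
    (if x \<in> cbox (\<chi> t. q i $ t - 1 / 2 ^ (k + 1)) (\<chi> t. q i $ t + 1 / 2 ^ (k + 1))
     then 1 / of_nat CARD('n) * exp (\<i> * complex_of_real (x $ j - q i $ j)) else 0)"
  using assms by (simp add: sd_E_def jones_xi_def jones_interval_def mem_box_cart)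

lemma cmod_sd_E_le:
  fixes q :: "nat \<Rightarrow> real ^ 'n"
  shows "cmod (sd_E q idx m x $ j) \<le> 1"
proof (cases "idx m")
  case (Pair k i)
  have "1 \<le> real CARD('n)" by simp
  then have "1 / real CARD('n) \<le> 1" by simp
  then show ?thesis
    unfolding sd_E_component[where idx = idx and m = m, OF Pair] by (simp add: norm_mult norm_divide del: of_real_diff)
qed

lemma cmod_sum_sd_E_le:
  "cmod (\<Sum>j\<in>UNIV. sd_E q idx m x $ j * y $ j) \<le> (\<Sum>j\<in>UNIV. cmod (y $ j))"
  using cmod_sd_E_le[of q idx m] by (intro sum_norm_le) (simp add: norm_mult mult_left_le_one_le)

text \<open>
  In the variable \<open>u\<close> of the cube, each component of \<open>E_m\<close> is \<open>1/n\<close> times the indicator of a box times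
  \<open>exp (i (tan u_j - c))\<close>. The last factor has modulus 1, and its variation on the box is at most the length
  \<open>2^-k \<le> 1\<close> of the original edge, whatever the position of the box. Hence \<open>K = 2\<close> works for all \<open>m\<close>.
\<close>

lemma equiintegrable_sd_dot:
  fixes f :: "real ^ 'n \<Rightarrow> complex ^ 'n"
  assumes f: "\<And>j. pullback (\<lambda>x. f x $ j) integrable_on angle_cube"
  shows "range (\<lambda>m. pullback (sd_dot q idx m f)) equiintegrable_on angle_cube"
proof -
  define F where "F j = pullback (\<lambda>x. f x $ j)" for j
  define M where "M i = {\<lambda>u. if u \<in> cbox c d then \<theta> (u $ j) * F i u else 0 | c d \<theta> j.
           continuous_on {c $ j..d $ j} \<theta> \<and>
           (\<exists>V. (\<forall>s t. c $ j \<le> s \<longrightarrow> s \<le> t \<longrightarrow> t \<le> d $ j \<longrightarrow> cmod (\<theta> t - \<theta> s) \<le> V t - V s) \<and>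
                cmod (\<theta> (c $ j)) + (V (d $ j) - V (c $ j)) \<le> 2)}" for i
  have "M i equiintegrable_on angle_cube" for i
    unfolding M_def by (rule equiintegrable_coordinate_multipliers) (simp_all add: F_def f)
  then have "(\<Union>i\<in>UNIV. M i) equiintegrable_on angle_cube"
    by (intro equiintegrable_on_finite_Union) simp_all
  then have "{\<lambda>x. \<Sum>i\<in>I. c i * g i x | (I :: 'n set) c g.
            finite I \<and> (\<forall>i\<in>I. g i \<in> (\<Union>i\<in>UNIV. M i)) \<and> (\<Sum>i\<in>I. cmod (c i)) \<le> 1} equiintegrable_on angle_cube"
      (is "?C equiintegrable_on _")
    by (rule equiintegrable_combinations) simp
  then have "{h. \<exists>f. range f \<subseteq> ?C \<and> (\<forall>x\<in>angle_cube. (\<lambda>n::nat. f n x) \<longlonglongrightarrow> h x)} equiintegrable_on angle_cube"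
      (is "?L equiintegrable_on _")
    by (rule equiintegrable_pointwise_limits)
  then show ?thesis
  proof (rule equiintegrable_on_subset)
    have "pullback (sd_dot q idx m f) \<in> ?L" for m
    proof (cases "idx m")
      case (Pair k i)
      define c d :: "real ^ 'n" where "c = (\<chi> t. arctan (q i $ t - 1 / 2 ^ (k + 1)))"
        and "d = (\<chi> t. arctan (q i $ t + 1 / 2 ^ (k + 1)))"
      define \<theta> where "\<theta> j s = exp (\<i> * complex_of_real (tan s - q i $ j))" for j s
      define h where "h j u = (if u \<in> cbox c d then \<theta> j (u $ j) * F j u else 0)" for j and u :: "real ^ 'n"
      have cos: "0 < cos s" if "c $ j \<le> s" "s \<le> d $ j" for j s
      proof (rule cos_gt_zero_pi)
        have "-(pi/2) < c $ j" "d $ j < pi/2"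
          unfolding c_def d_def vec_lambda_beta by (rule arctan_lbound arctan_ubound)+
        then show "-(pi/2) < s" "s < pi/2" using that by linarith+
      qed
      have "h j \<in> M j" for j
        unfolding M_def
      proof (intro CollectI exI conjI allI impI)
        show "h j = (\<lambda>u. if u \<in> cbox c d then \<theta> j (u $ j) * F j u else 0)"
          by (rule ext) (simp only: h_def)
        show "continuous_on {c $ j..d $ j} (\<theta> j)"
          unfolding \<theta>_def by (intro continuous_intros) (use cos less_imp_neq in fastforce)
        show "cmod (\<theta> j (c $ j)) + (tan (d $ j) - tan (c $ j)) \<le> 2"
        proof -
          have "tan (d $ j) - tan (c $ j) = 2 * (1 / 2 ^ (k + 1))"
            by (simp add: c_def d_def tan_arctan)
          also have "\<dots> \<le> 1" by simp
          finally show ?thesis unfolding \<theta>_def by (simp only: norm_exp_i_times)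
        qed
        fix s t assume "c $ j \<le> s" "s \<le> t" "t \<le> d $ j"
        then have "tan s \<le> tan t"
          using arctan_lbound[of "q i $ j - 1 / 2 ^ (k + 1)"] arctan_ubound[of "q i $ j + 1 / 2 ^ (k + 1)"]
          by (intro tan_mono_le) (simp_all add: c_def d_def)
        then show "cmod (\<theta> j t - \<theta> j s) \<le> tan t - tan s"
          using norm_exp_i_diff_le[of "tan t - q i $ j" "tan s - q i $ j"] unfolding \<theta>_def by linarith
      qed
      then have C: "(\<lambda>u. \<Sum>j\<in>UNIV. 1 / of_nat CARD('n) * h j u) \<in> ?C"
        by (intro CollectI exI[of _ UNIV] exI[of _ "\<lambda>j. 1 / of_nat CARD('n)"] exI[of _ h] conjI refl)
           (auto simp: norm_divide)
      have "pullback (sd_dot q idx m f) u = (\<Sum>j\<in>UNIV. 1 / of_nat CARD('n) * h j u)"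
        if u: "u \<in> angle_cube" for u
      proof (cases "u \<in> open_angle_cube")
        case False
        then have "tan_jacobian u = 0" using u by (intro tan_jacobian_boundary) blast
        then have "F j u = 0" for j by (simp add: F_def pullback_def)
        then have "h j u = 0" for j by (simp add: h_def)
        then show ?thesis using \<open>tan_jacobian u = 0\<close> by (simp add: pullback_def)
      next
        case True
        let ?x = "\<chi> j. tan (u $ j)"
        have tan: "arctan (tan (u $ t)) = u $ t" for t
          using True unfolding mem_box_cart vec_lambda_beta by (intro arctan_tan) blast+
        have "?x \<in> cbox (\<chi> t. q i $ t - 1 / 2 ^ (k + 1)) (\<chi> t. q i $ t + 1 / 2 ^ (k + 1)) \<longleftrightarrow> u \<in> cbox c d"
        proof -
          have "a \<le> tan (u $ t) \<longleftrightarrow> arctan a \<le> u $ t" "tan (u $ t) \<le> a \<longleftrightarrow> u $ t \<le> arctan a" for a t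
            using arctan_le_iff[of a "tan (u $ t)"] arctan_le_iff[of "tan (u $ t)" a] by (simp_all only: tan)
          then show ?thesis by (simp only: mem_box_cart c_def d_def vec_lambda_beta)
        qed
        then have "sd_E q idx m ?x $ j * F j u = 1 / of_nat CARD('n) * h j u" for j
          unfolding sd_E_component[where idx = idx and m = m, OF Pair] h_def \<theta>_def by simp
        moreover have "pullback (sd_dot q idx m f) u = (\<Sum>j\<in>UNIV. sd_E q idx m ?x $ j * F j u)"
          by (simp add: pullback_def sd_dot_def F_def scaleR_sum_right mult_scaleR_right)
        ultimately show ?thesis by simp
      qed
      then show ?thesis
        using C by (intro CollectI exI[of _ "\<lambda>n u. \<Sum>j\<in>UNIV. 1 / of_nat CARD('n) * h j u"] conjI ballI) auto
    qed
    then show "range (\<lambda>m. pullback (sd_dot q idx m f)) \<subseteq> ?L" by (rule image_subsetI)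
  qed
qed

lemma HK_iff_pullback: "f \<in> HK \<longleftrightarrow> (\<forall>j. pullback (\<lambda>x. f x $ j) integrable_on angle_cube)"
  by (simp add: HK_def hk_integrable_iff_pullback)

lemma pullback_sd_dot_integrable:
  assumes "f \<in> HK"
  shows "pullback (sd_dot q idx m f) integrable_on angle_cube"
  using assms equiintegrable_on_integrable[OF equiintegrable_sd_dot] unfolding HK_iff_pullback by blast

lemma hk_integrable_sd_dot: "f \<in> HK \<Longrightarrow> hk_integrable (sd_dot q idx m f)"
  by (simp add: hk_integrable_iff_pullback pullback_sd_dot_integrable)

text \<open>
  The uniform approximation of all moments by those of finitely many point masses. The points are the tags of a
  fine division and the masses are values of \<open>f\<close> times volumes. Setting \<open>f\<close> to zero on
  the grid determined by \<open>S\<close> costs nothing and removes all masses from it.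
\<close>

lemma hk_moment_uniform_point_masses:
  fixes f :: "real ^ 'n \<Rightarrow> complex ^ 'n"
  assumes f: "f \<in> HK" and S: "countable S" and "e > 0"
  obtains A :: "((real ^ 'n) \<times> (real ^ 'n) set) set" and x y
  where "finite A" "\<And>a. a \<in> A \<Longrightarrow> y a = 0 \<or> (\<forall>j. x a $ j \<notin> S)"
    "\<And>m. cmod ((\<Sum>a\<in>A. \<Sum>j\<in>UNIV. sd_E q idx m (x a) $ j * y a $ j) - hk_moment q idx f m) < e"
proof -
  define f0 where "f0 x = (if \<exists>j. x $ j \<in> S then 0 else f x)" for x
  have eq: "f x = f0 x" if "\<And>j. x $ j \<notin> S" for x using that by (simp add: f0_def)
  have "pullback (\<lambda>x. f0 x $ j) integrable_on angle_cube" for j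
  proof -
    have "\<exists>I. (pullback (\<lambda>x. f x $ j) has_integral I) angle_cube"
      using f unfolding HK_iff_pullback integrable_on_def by blast
    then obtain I where I: "(pullback (\<lambda>x. f x $ j) has_integral I) angle_cube" ..
    have "(pullback (\<lambda>x. f0 x $ j) has_integral I) angle_cube"
      by (rule has_integral_pullback_off_grid[OF S _ I]) (simp add: eq)
    then show ?thesis by (rule has_integral_integrable)
  qed
  then have equi: "range (\<lambda>m. pullback (sd_dot q idx m f0)) equiintegrable_on angle_cube"
    by (rule equiintegrable_sd_dot)
  have moment: "integral angle_cube (pullback (sd_dot q idx m f0)) = hk_moment q idx f m" for m
  proof -
    have int: "pullback (sd_dot q idx m f) integrable_on angle_cube"
      using f by (rule pullback_sd_dot_integrable)
    have "(pullback (sd_dot q idx m f0) has_integral integral angle_cube (pullback (sd_dot q idx m f))) angle_cube"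
      by (rule has_integral_pullback_off_grid[OF S _ integrable_integral[OF int]])
         (simp add: sd_dot_def eq)
    then show ?thesis
      unfolding hk_moment_def hk_integral_eq_pullback[OF int] by (rule integral_unique)
  qed
  from equi[unfolded equiintegrable_on_def, THEN conjunct2, THEN spec, THEN mp, OF \<open>e > 0\<close>]
  obtain \<gamma> where \<gamma>: "gauge \<gamma>" "\<forall>g \<D>. g \<in> range (\<lambda>m. pullback (sd_dot q idx m f0)) \<and> \<D> tagged_division_of angle_cube \<and> \<gamma> fine \<D> \<longrightarrow>
      norm ((\<Sum>(x, k)\<in>\<D>. content k *\<^sub>R g x) - integral angle_cube g) < e"
    by (elim exE conjE)
  obtain p where p: "p tagged_division_of (angle_cube :: (real ^ 'n) set)" "\<gamma> fine p"
    by (rule fine_division_exists[OF \<gamma>(1)]) (rule that)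
  let ?x = "\<lambda>a :: (real ^ 'n) \<times> (real ^ 'n) set. \<chi> j. tan (fst a $ j)"
  let ?y = "\<lambda>a :: (real ^ 'n) \<times> (real ^ 'n) set. (content (snd a) * tan_jacobian (fst a)) *\<^sub>R f0 (?x a)"
  show thesis
  proof (rule that[of p ?y ?x])
    show "finite p" using p(1) by (rule tagged_division_of_finite)
    show "?y a = 0 \<or> (\<forall>j. ?x a $ j \<notin> S)" for a
      unfolding f0_def by simp
    fix m
    have "(\<Sum>a\<in>p. \<Sum>j\<in>UNIV. sd_E q idx m (?x a) $ j * ?y a $ j)
        = (\<Sum>(u, k)\<in>p. content k *\<^sub>R pullback (sd_dot q idx m f0) u)"
      by (simp add: case_prod_unfold pullback_def sd_dot_def scaleR_sum_right mult_scaleR_right)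
    moreover have "cmod ((\<Sum>(u, k)\<in>p. content k *\<^sub>R pullback (sd_dot q idx m f0) u)
        - integral angle_cube (pullback (sd_dot q idx m f0))) < e"
      by (intro \<gamma>(2)[THEN spec, THEN spec, THEN mp] conjI p rangeI)
    ultimately show "cmod ((\<Sum>a\<in>p. \<Sum>j\<in>UNIV. sd_E q idx m (?x a) $ j * ?y a $ j) - hk_moment q idx f m) < e"
      by (simp only: moment)
  qed
qed

lemma bounded_hk_moment:
  fixes f :: "real ^ 'n \<Rightarrow> complex ^ 'n"
  assumes "f \<in> HK"
  shows "bounded (range (hk_moment q idx f))"
proof -
  obtain A :: "((real ^ 'n) \<times> (real ^ 'n) set) set" and x y where "finite A" "\<And>a. a \<in> A \<Longrightarrow> y a = 0 \<or> (\<forall>j. x a $ j \<notin> {})"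
    and A: "\<And>m. cmod ((\<Sum>a\<in>A. \<Sum>j\<in>UNIV. sd_E q idx m (x a) $ j * y a $ j) - hk_moment q idx f m) < 1"
    by (rule hk_moment_uniform_point_masses[OF assms countable_empty zero_less_one, of q idx]) (rule that)
  have "cmod (\<Sum>a\<in>A. \<Sum>j\<in>UNIV. sd_E q idx m (x a) $ j * y a $ j) \<le> (\<Sum>a\<in>A. \<Sum>j\<in>UNIV. cmod (y a $ j))" for m
    by (rule sum_norm_le) (rule cmod_sum_sd_E_le)
  note bound = this
  have "cmod (hk_moment q idx f m) \<le> (\<Sum>a\<in>A. \<Sum>j\<in>UNIV. cmod (y a $ j)) + 1" for m
  proof -
    let ?s = "\<Sum>a\<in>A. \<Sum>j\<in>UNIV. sd_E q idx m (x a) $ j * y a $ j"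
    have "cmod (hk_moment q idx f m) \<le> cmod ?s + cmod (hk_moment q idx f m - ?s)"
      by (rule norm_triangle_sub)
    also have "\<dots> \<le> (\<Sum>a\<in>A. \<Sum>j\<in>UNIV. cmod (y a $ j)) + 1"
      using A[of m] bound[of m] unfolding norm_minus_commute[of "hk_moment q idx f m"] by linarith
    finally show ?thesis .
  qed
  then show ?thesis unfolding bounded_iff by blast
qed

section \<open>Point masses as limits of integrable functions\<close>

text \<open>
  The mass at \<open>x\<close> is smeared over a cube with corner \<open>x\<close>; a corner serves as well as the centre because it is used
  only at points of continuity.
\<close>

definition bump_box :: "real ^ 'n \<Rightarrow> nat \<Rightarrow> (real ^ 'n) set" where
  "bump_box x l = cbox x (\<chi> j. x $ j + 1 / real (Suc l))"

definition bump :: "real ^ 'n \<Rightarrow> nat \<Rightarrow> real ^ 'n \<Rightarrow> real" where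
  "bump x l z = real (Suc l) ^ CARD('n) * indicat_real (bump_box x l) z"

lemma bump_box_content: "real (Suc l) ^ CARD('n) * content (bump_box (x :: real ^ 'n) l) = 1"
proof -
  have "x \<in> bump_box x l" by (simp add: bump_box_def mem_box_cart)
  then have "content (bump_box x l) = (1 / real (Suc l)) ^ CARD('n)"
    unfolding bump_box_def by (subst content_cbox_cart) auto
  then show ?thesis by (simp add: power_one_over)
qed

lemma integrable_bump_scaleR:
  fixes h :: "real ^ 'n \<Rightarrow> 'b::{banach, second_countable_topology}"
  assumes "h \<in> borel_measurable lebesgue" "\<And>z. norm (h z) \<le> M"
  shows "integrable lebesgue (\<lambda>z. bump x l z *\<^sub>R h z)"
proof (rule Bochner_Integration.integrable_bound)
  have "integrable lebesgue (indicat_real (bump_box x l))"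
    unfolding bump_box_def by (intro integrable_real_indicator) (auto simp: emeasure_lborel_cbox_eq)
  then show "integrable lebesgue (\<lambda>z. M * bump x l z)"
    unfolding bump_def by (intro integrable_mult_right)
  have "bump_box x l \<in> sets lebesgue" by (simp add: bump_box_def)
  then show "(\<lambda>z. bump x l z *\<^sub>R h z) \<in> borel_measurable lebesgue"
    unfolding bump_def using assms(1) by (intro borel_measurable_scaleR borel_measurable_times borel_measurable_indicator) simp_all
  have "0 \<le> bump x l z" for z by (simp add: bump_def)
  then have "norm (bump x l z *\<^sub>R h z) \<le> norm (M * bump x l z)" for z
    using mult_right_mono[OF order_trans[OF assms(2) abs_ge_self], of "bump x l z" z]
    by (simp add: abs_mult mult.commute)
  then show "AE z in lebesgue. norm (bump x l z *\<^sub>R h z) \<le> norm (M * bump x l z)" by simp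
qed

lemma bump_average_near:
  fixes h :: "real ^ 'n \<Rightarrow> complex"
  assumes h: "h \<in> borel_measurable lebesgue" "\<And>z. cmod (h z) \<le> M"
    and near: "\<And>z. z \<in> bump_box x l \<Longrightarrow> cmod (h z - c) \<le> e"
  shows "cmod ((LINT z|lebesgue. bump x l z *\<^sub>R h z) - c) \<le> e"
proof -
  let ?w = "real (Suc l) ^ CARD('n)" and ?B = "bump_box x l"
  have x: "x \<in> ?B" by (simp add: bump_box_def mem_box_cart)
  then have "0 \<le> e" using near[of x] norm_ge_zero order_trans by blast
  have "integrable lebesgue (\<lambda>z. (1 / ?w) *\<^sub>R (bump x l z *\<^sub>R h z))"
    by (intro integrable_scaleR_right integrable_bump_scaleR[OF h])
  moreover have "(1 / ?w) *\<^sub>R (bump x l z *\<^sub>R h z) = indicat_real ?B z *\<^sub>R h z" for z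
    by (simp add: bump_def)
  ultimately have B: "set_integrable lebesgue ?B h"
    unfolding set_integrable_def by (simp only:)
  have "(LINT z|lebesgue. bump x l z *\<^sub>R h z) = ?w *\<^sub>R (LINT z:?B|lebesgue. h z)"
    unfolding bump_def set_lebesgue_integral_def scaleR_scaleR[symmetric] by (rule integral_scaleR_right)
  also have "\<dots> = ?w *\<^sub>R integral ?B h"
    by (simp only: set_lebesgue_integral_eq_integral(2)[OF B])
  finally have eq: "(LINT z|lebesgue. bump x l z *\<^sub>R h z) = ?w *\<^sub>R integral ?B h" .
  have "(h has_integral integral ?B h) ?B"
    using set_lebesgue_integral_eq_integral(1)[OF B] by (rule integrable_integral)
  moreover have "((\<lambda>z. c) has_integral content ?B *\<^sub>R c) ?B"
    unfolding bump_box_def by (rule has_integral_const)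
  ultimately have "((\<lambda>z. h z - c) has_integral (integral ?B h - content ?B *\<^sub>R c)) ?B"
    by (rule has_integral_diff)
  then have "norm (integral ?B h - content ?B *\<^sub>R c) \<le> e * content ?B"
    using near \<open>0 \<le> e\<close> unfolding bump_box_def by (intro has_integral_bound)
  then have "?w * norm (integral ?B h - content ?B *\<^sub>R c) \<le> ?w * (e * content ?B)"
    by (rule mult_left_mono) simp
  also have "\<dots> = e" using bump_box_content[of l x] by (simp add: algebra_simps)
  also have "?w * norm (integral ?B h - content ?B *\<^sub>R c) = norm (?w *\<^sub>R (integral ?B h - content ?B *\<^sub>R c))"
    by simp
  also have "?w *\<^sub>R (integral ?B h - content ?B *\<^sub>R c) = ?w *\<^sub>R integral ?B h - c"
    using bump_box_content[of l x] by (simp add: scaleR_right_diff_distrib del: of_nat_Suc)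
  finally show ?thesis by (simp only: eq)
qed

lemma bump_box_small:
  assumes "z \<in> bump_box (x :: real ^ 'n) l"
  shows "dist z x \<le> real CARD('n) / real (Suc l)"
proof -
  have "\<bar>(z - x) $ j\<bar> \<le> 1 / real (Suc l)" for j
  proof -
    have "x $ j \<le> z $ j" "z $ j \<le> x $ j + 1 / real (Suc l)"
      using assms unfolding bump_box_def mem_box_cart vec_lambda_beta by blast+
    then show ?thesis by simp
  qed
  then have "(\<Sum>j\<in>UNIV. \<bar>(z - x) $ j\<bar>) \<le> of_nat CARD('n) * (1 / real (Suc l))"
    by (intro sum_bounded_above)
  then show ?thesis
    using norm_le_l1_cart[of "z - x"] unfolding dist_norm by simp
qed

lemma bump_average_tendsto:
  fixes h :: "real ^ 'n \<Rightarrow> complex"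
  assumes h: "h \<in> borel_measurable lebesgue" "\<And>z. cmod (h z) \<le> M" and "isCont h x"
  shows "(\<lambda>l. LINT z|lebesgue. bump x l z *\<^sub>R h z) \<longlonglongrightarrow> h x"
proof (rule tendstoI)
  fix e :: real assume "e > 0"
  then have "e / 2 > 0" by simp
  with \<open>isCont h x\<close> obtain d where d: "d > 0" "\<And>z. dist z x < d \<Longrightarrow> dist (h z) (h x) < e / 2"
    unfolding continuous_at_eps_delta by blast
  have "(\<lambda>l. real CARD('n) / real (Suc l)) \<longlonglongrightarrow> 0"
    using LIMSEQ_Suc[OF lim_const_over_n[of "real CARD('n)"]] by simp
  then have "\<forall>\<^sub>F l in sequentially. real CARD('n) / real (Suc l) < d"
    using \<open>d > 0\<close> by (rule order_tendstoD)
  then show "\<forall>\<^sub>F l in sequentially. dist (LINT z|lebesgue. bump x l z *\<^sub>R h z) (h x) < e"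
  proof eventually_elim
    case (elim l)
    have "cmod ((LINT z|lebesgue. bump x l z *\<^sub>R h z) - h x) \<le> e / 2"
    proof (rule bump_average_near[OF h])
      fix z assume "z \<in> bump_box x l"
      then have "dist z x < d" using bump_box_small[of z x l] elim by linarith
      then show "cmod (h z - h x) \<le> e / 2" using d(2)[of z] by (simp add: dist_norm)
    qed
    then show ?case using \<open>e > 0\<close> by (simp add: dist_norm)
  qed
qed

lemma borel_measurable_sd_E: "(\<lambda>x. sd_E q idx m x $ j) \<in> borel_measurable lebesgue"
proof (cases "idx m")
  case (Pair k i)
  have "(\<lambda>x. sd_E q idx m x $ j) \<in> borel_measurable borel"
    unfolding sd_E_component[where idx = idx and m = m, OF Pair]
    by (intro borel_measurable_continuous_on_if continuous_intros) simp_all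
  then show ?thesis by (intro measurable_completion) simp
qed

text \<open>
  The coordinates of the faces of all cubes, over all centres and sizes.
\<close>

definition cube_faces :: "(nat \<Rightarrow> real ^ 'n) \<Rightarrow> real set" where
  "cube_faces q = (\<Union>i j. \<Union>k::nat. {q i $ j - 1 / 2 ^ (k + 1), q i $ j + 1 / 2 ^ (k + 1)})"

lemma countable_cube_faces: "countable (cube_faces q)"
  unfolding cube_faces_def by (intro countable_UN countable_insert countable_empty) (simp_all add: countable_finite)

lemma isCont_sd_E:
  fixes q :: "nat \<Rightarrow> real ^ 'n"
  assumes "\<And>j. x $ j \<notin> cube_faces q"
  shows "isCont (\<lambda>x. sd_E q idx m x $ j) x"
proof (cases "idx m")
  case (Pair k i)
  let ?c = "\<chi> t. q i $ t - 1 / 2 ^ (k + 1)" and ?d = "\<chi> t. q i $ t + 1 / 2 ^ (k + 1)"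
  have ne: "x $ t \<noteq> q i $ t - 1 / 2 ^ (k + 1)" "x $ t \<noteq> q i $ t + 1 / 2 ^ (k + 1)" for t
    using assms[of t] unfolding cube_faces_def by blast+
  show ?thesis
  proof (cases "x \<in> cbox ?c ?d")
    case True
    then have "x \<in> box ?c ?d"
      using ne unfolding mem_box_cart vec_lambda_beta by (metis order_le_less)
    then have ev: "\<forall>\<^sub>F y in nhds x. y \<in> box ?c ?d"
      using open_box eventually_nhds by blast
    have "\<forall>\<^sub>F y in nhds x. sd_E q idx m y $ j = 1 / of_nat CARD('n) * exp (\<i> * complex_of_real (y $ j - q i $ j))"
    proof (rule eventually_mono[OF ev])
      fix y assume "y \<in> box ?c ?d"
      then have "y \<in> cbox ?c ?d" using box_subset_cbox by blast
      then show "sd_E q idx m y $ j = 1 / of_nat CARD('n) * exp (\<i> * complex_of_real (y $ j - q i $ j))"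
        by (simp only: sd_E_component[where idx = idx and m = m, OF Pair] if_True)
    qed
    moreover have "isCont (\<lambda>y. 1 / of_nat CARD('n) * exp (\<i> * complex_of_real (y $ j - q i $ j))) x"
      by (intro continuous_intros)
    ultimately show ?thesis by (simp only: isCont_cong)
  next
    case False
    then have "x \<in> - cbox ?c ?d" by blast
    moreover have "open (- cbox ?c ?d)" by (simp add: closed_cbox open_Compl)
    ultimately have ev: "\<forall>\<^sub>F y in nhds x. y \<in> - cbox ?c ?d"
      using eventually_nhds by blast
    have "\<forall>\<^sub>F y in nhds x. sd_E q idx m y $ j = 0"
      by (rule eventually_mono[OF ev])
         (simp only: sd_E_component[where idx = idx and m = m, OF Pair] Compl_iff if_False)
    then show ?thesis by (simp only: isCont_cong continuous_const)
  qed
qed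

definition smeared_masses :: "'a set \<Rightarrow> ('a \<Rightarrow> real ^ 'n) \<Rightarrow> ('a \<Rightarrow> complex ^ 'n) \<Rightarrow> nat \<Rightarrow> real ^ 'n \<Rightarrow> complex ^ 'n" where
  "smeared_masses A x y l z = (\<Sum>a\<in>A. bump (x a) l z *\<^sub>R y a)"

lemma smeared_masses_L1: "smeared_masses A x y l \<in> L1"
  unfolding L1_def smeared_masses_def
  by (auto intro!: Bochner_Integration.integrable_sum integrable_bump_scaleR)

lemma sd_moment_smeared_masses:
  fixes q :: "nat \<Rightarrow> real ^ 'n"
  shows "sd_moment q idx (smeared_masses A x y l) m =
    (\<Sum>a\<in>A. LINT z|lebesgue. bump (x a) l z *\<^sub>R (\<Sum>j\<in>UNIV. sd_E q idx m z $ j * y a $ j))"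
proof -
  have meas: "(\<lambda>z. \<Sum>j\<in>UNIV. sd_E q idx m z $ j * y a $ j) \<in> borel_measurable lebesgue" for a
    by (intro borel_measurable_sum borel_measurable_times borel_measurable_sd_E borel_measurable_const)
  have bound: "cmod (\<Sum>j\<in>UNIV. sd_E q idx m z $ j * y a $ j) \<le> (\<Sum>j\<in>UNIV. cmod (y a $ j))" for z a
    by (rule cmod_sum_sd_E_le)
  have eq: "sd_dot q idx m (smeared_masses A x y l)
      = (\<lambda>z. \<Sum>a\<in>A. bump (x a) l z *\<^sub>R (\<Sum>j\<in>UNIV. sd_E q idx m z $ j * y a $ j))"
    by (rule ext) (simp add: sd_dot_def smeared_masses_def sum_distrib_left scaleR_sum_right mult_scaleR_right sum.swap[of _ A])
  show ?thesis
    unfolding sd_moment_def eq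
    by (rule Bochner_Integration.integral_sum) (rule integrable_bump_scaleR[OF meas bound])
qed

definition square_sum :: "(nat \<Rightarrow> complex) \<Rightarrow> real" where
  "square_sum d = (\<Sum>m. 1 / 2 ^ Suc m * (cmod (d (Suc m)))\<^sup>2)"

lemma weighted_square_le:
  assumes "cmod z \<le> M"
  shows "norm (1 / 2 ^ Suc m * (cmod z)\<^sup>2) \<le> (1 / 2) ^ m * M\<^sup>2"
proof -
  have "1 / 2 ^ Suc m * (cmod z)\<^sup>2 \<le> (1 / 2) ^ m * M\<^sup>2"
  proof (rule mult_mono)
    show "(cmod z)\<^sup>2 \<le> M\<^sup>2" using assms by (rule power_mono) simp
    have "(0::real) < 2 ^ m" by simp
    then show "1 / 2 ^ Suc m \<le> (1 / 2 :: real) ^ m"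
      by (simp add: power_one_over field_simps)
  qed simp_all
  then show ?thesis by simp
qed

text \<open>
  Convergence of each single moment is enough for convergence in the weighted square norm, since the
  moments of the smeared masses are bounded by the total mass and the weights are summable.
\<close>

lemma square_sum_smeared_masses:
  fixes q :: "nat \<Rightarrow> real ^ 'n" and y :: "'a \<Rightarrow> complex ^ 'n"
  assumes off: "\<And>a. a \<in> A \<Longrightarrow> y a = 0 \<or> (\<forall>j. x a $ j \<notin> cube_faces q)"
  shows "(\<lambda>l. square_sum (\<lambda>m. sd_moment q idx (smeared_masses A x y l) m
      - (\<Sum>a\<in>A. \<Sum>j\<in>UNIV. sd_E q idx m (x a) $ j * y a $ j))) \<longlonglongrightarrow> 0"
proof -
  define h where "h m a z = (\<Sum>j\<in>UNIV. sd_E q idx m z $ j * y a $ j)" for m a z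
  define d where "d l m = (\<Sum>a\<in>A. LINT z|lebesgue. bump (x a) l z *\<^sub>R h m a z) - (\<Sum>a\<in>A. h m a (x a))" for l m
  define Y where "Y = (\<Sum>a\<in>A. \<Sum>j\<in>UNIV. cmod (y a $ j))"
  have meas: "h m a \<in> borel_measurable lebesgue" for m a
    unfolding h_def by (intro borel_measurable_sum borel_measurable_times borel_measurable_sd_E borel_measurable_const)
  have bound: "cmod (h m a z) \<le> (\<Sum>j\<in>UNIV. cmod (y a $ j))" for m a z
    unfolding h_def by (rule cmod_sum_sd_E_le)
  have avg: "cmod (LINT z|lebesgue. bump (x a) l z *\<^sub>R h m a z) \<le> (\<Sum>j\<in>UNIV. cmod (y a $ j))" for l m a
  proof -
    have "cmod ((LINT z|lebesgue. bump (x a) l z *\<^sub>R h m a z) - 0) \<le> (\<Sum>j\<in>UNIV. cmod (y a $ j))"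
      by (rule bump_average_near[OF meas bound]) (simp only: diff_zero bound)
    then show ?thesis by (simp only: diff_zero)
  qed
  have "(\<lambda>l. LINT z|lebesgue. bump (x a) l z *\<^sub>R h m a z) \<longlonglongrightarrow> h m a (x a)" if "a \<in> A" for m a
  proof (cases "y a = 0")
    case True
    then show ?thesis by (simp add: h_def)
  next
    case False
    then have "isCont (\<lambda>z. sd_E q idx m z $ j) (x a)" for j
      using off[OF that] by (intro isCont_sd_E) blast
    then have "isCont (h m a) (x a)"
      unfolding h_def by (intro continuous_sum continuous_mult continuous_const)
    then show ?thesis by (rule bump_average_tendsto[OF meas bound])
  qed
  then have "(\<lambda>l. d l m) \<longlonglongrightarrow> (\<Sum>a\<in>A. h m a (x a)) - (\<Sum>a\<in>A. h m a (x a))" for m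
    unfolding d_def by (intro tendsto_diff tendsto_sum tendsto_const)
  then have "(\<lambda>l. 1 / 2 ^ Suc m * (cmod (d l (Suc m)))\<^sup>2) \<longlonglongrightarrow> 1 / 2 ^ Suc m * (cmod 0)\<^sup>2" for m
    by (intro tendsto_mult tendsto_const tendsto_power tendsto_norm) simp
  then have lim: "(\<lambda>l. 1 / 2 ^ Suc m * (cmod (d l (Suc m)))\<^sup>2) \<longlonglongrightarrow> 0" for m
    by simp
  have "cmod (d l m) \<le> Y + Y" for l m
    unfolding d_def Y_def
    by (intro order_trans[OF norm_triangle_ineq4] add_mono sum_norm_le avg bound)
  then have "norm (1 / 2 ^ Suc m * (cmod (d l (Suc m)))\<^sup>2) \<le> (1 / 2) ^ m * (Y + Y)\<^sup>2" for l m
    by (rule weighted_square_le)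
  moreover have "summable (\<lambda>m. (1 / 2) ^ m * (Y + Y)\<^sup>2)"
    by (intro summable_mult2 summable_geometric) simp
  ultimately have "(\<lambda>l. \<Sum>m. 1 / 2 ^ Suc m * (cmod (d l (Suc m)))\<^sup>2) \<longlonglongrightarrow> (\<Sum>m. 0 :: real)"
    by (intro tannerys_theorem[OF lim, THEN conjunct2, THEN conjunct2]) (auto intro!: always_eventually)
  then show ?thesis
    by (simp add: square_sum_def sd_moment_smeared_masses d_def h_def)
qed

section \<open>The weighted square norm and the completion\<close>

lemma summable_square_sum:
  assumes "bounded (range d)"
  shows "summable (\<lambda>m. 1 / 2 ^ Suc m * (cmod (d (Suc m)))\<^sup>2)"
proof -
  obtain M where M: "\<And>m. cmod (d m) \<le> M"
    using assms unfolding bounded_iff by blast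
  have "summable (\<lambda>m. (1 / 2) ^ m * M\<^sup>2)"
    by (intro summable_mult2 summable_geometric) simp
  moreover have "norm (1 / 2 ^ Suc m * (cmod (d (Suc m)))\<^sup>2) \<le> (1 / 2) ^ m * M\<^sup>2" for m
    by (rule weighted_square_le[OF M])
  ultimately show ?thesis by (rule summable_comparison_test'[where N = 0])
qed

lemma square_sum_nonneg: "bounded (range d) \<Longrightarrow> 0 \<le> square_sum d"
  unfolding square_sum_def by (intro suminf_nonneg summable_square_sum) simp_all

lemma Re_sd_form_self:
  assumes "bounded (range d)"
  shows "Re (sd_form d d) = square_sum d"
proof -
  have "1 / 2 ^ Suc m * (d (Suc m) * cnj (d (Suc m))) = complex_of_real (1 / 2 ^ Suc m * (cmod (d (Suc m)))\<^sup>2)" for m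
    by (simp only: complex_norm_square[symmetric] of_real_mult of_real_divide of_real_1 of_real_power of_real_numeral)
  then show ?thesis
    unfolding sd_form_def square_sum_def
    by (simp only: suminf_of_real[OF summable_square_sum[OF assms], symmetric] Re_complex_of_real)
qed

lemma bounded_range_diff:
  fixes d e :: "nat \<Rightarrow> complex"
  shows "bounded (range d) \<Longrightarrow> bounded (range e) \<Longrightarrow> bounded (range (\<lambda>m. d m - e m))"
  by (rule bounded_minus_comp)

text \<open>
  A substitute for the triangle inequality that works with squares and suffices for
  statements about limits.
\<close>

lemma square_sum_diff_le:
  assumes d: "bounded (range d)" and e: "bounded (range e)"
  shows "square_sum (\<lambda>m. d m - e m) \<le> 2 * square_sum d + 2 * square_sum e"
proof -
  have le: "(cmod (z - w))\<^sup>2 \<le> 2 * (cmod z)\<^sup>2 + 2 * (cmod w)\<^sup>2" for z w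
  proof -
    have "(cmod (z - w))\<^sup>2 \<le> (cmod z + cmod w)\<^sup>2"
      by (intro power_mono norm_triangle_ineq4 norm_ge_zero)
    also have "\<dots> \<le> 2 * (cmod z)\<^sup>2 + 2 * (cmod w)\<^sup>2"
      using sum_squares_bound[of "cmod z" "cmod w"] by (simp add: power2_sum)
    finally show ?thesis .
  qed
  note sd = summable_square_sum[OF d] and se = summable_square_sum[OF e]
  have "square_sum (\<lambda>m. d m - e m) \<le> (\<Sum>m. 2 * (1 / 2 ^ Suc m * (cmod (d (Suc m)))\<^sup>2) + 2 * (1 / 2 ^ Suc m * (cmod (e (Suc m)))\<^sup>2))"
    unfolding square_sum_def
  proof (rule suminf_le)
    show "summable (\<lambda>m. 1 / 2 ^ Suc m * (cmod (d (Suc m) - e (Suc m)))\<^sup>2)"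
      using summable_square_sum[OF bounded_range_diff[OF d e]] .
    show "summable (\<lambda>m. 2 * (1 / 2 ^ Suc m * (cmod (d (Suc m)))\<^sup>2) + 2 * (1 / 2 ^ Suc m * (cmod (e (Suc m)))\<^sup>2))"
      by (intro summable_add summable_mult sd se)
    fix m
    have "1 / 2 ^ Suc m * (cmod (d (Suc m) - e (Suc m)))\<^sup>2
        \<le> 1 / 2 ^ Suc m * (2 * (cmod (d (Suc m)))\<^sup>2 + 2 * (cmod (e (Suc m)))\<^sup>2)"
      by (rule mult_left_mono[OF le]) simp
    then show "1 / 2 ^ Suc m * (cmod (d (Suc m) - e (Suc m)))\<^sup>2
        \<le> 2 * (1 / 2 ^ Suc m * (cmod (d (Suc m)))\<^sup>2) + 2 * (1 / 2 ^ Suc m * (cmod (e (Suc m)))\<^sup>2)"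
      by (simp only: distrib_left mult.left_commute)
  qed
  also have "\<dots> = 2 * square_sum d + 2 * square_sum e"
    unfolding square_sum_def
    by (simp only: suminf_add[OF summable_mult[OF sd] summable_mult[OF se], symmetric] suminf_mult[OF sd] suminf_mult[OF se])
  finally show ?thesis .
qed

lemma integrable_sd_dot:
  fixes q :: "nat \<Rightarrow> real ^ 'n"
  assumes "f \<in> L1"
  shows "integrable lebesgue (sd_dot q idx m f)"
proof -
  have f: "integrable lebesgue (\<lambda>x. f x $ j)" for j
    using assms by (simp add: L1_def)
  have *: "integrable lebesgue (\<lambda>x. sd_E q idx m x $ j * f x $ j)" for j
  proof (rule Bochner_Integration.integrable_bound[OF f[of j]])
    show "(\<lambda>x. sd_E q idx m x $ j * f x $ j) \<in> borel_measurable lebesgue"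
      by (intro borel_measurable_times borel_measurable_sd_E borel_measurable_integrable f)
    show "AE x in lebesgue. norm (sd_E q idx m x $ j * f x $ j) \<le> norm (f x $ j)"
      using cmod_sd_E_le[of q idx m] by (simp add: norm_mult mult_left_le_one_le)
  qed
  show "integrable lebesgue (sd_dot q idx m f)"
    unfolding sd_dot_def[abs_def] by (intro Bochner_Integration.integrable_sum *)
qed

lemma bounded_sd_moment:
  fixes q :: "nat \<Rightarrow> real ^ 'n"
  assumes "f \<in> L1"
  shows "bounded (range (sd_moment q idx f))"
proof -
  have f: "integrable lebesgue (\<lambda>x. norm (f x $ j))" for j
    using assms by (simp add: L1_def)
  have "cmod (sd_moment q idx f m) \<le> (LINT x|lebesgue. (\<Sum>j\<in>UNIV. norm (f x $ j)))" for m
  proof -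
    have int: "integrable lebesgue (sd_dot q idx m f)" using assms by (rule integrable_sd_dot)
    have "cmod (sd_moment q idx f m) \<le> (LINT x|lebesgue. norm (sd_dot q idx m f x))"
      unfolding sd_moment_def by (rule integral_norm_bound)
    also have "\<dots> \<le> (LINT x|lebesgue. (\<Sum>j\<in>UNIV. norm (f x $ j)))"
    proof (rule integral_mono)
      show "integrable lebesgue (\<lambda>x. norm (sd_dot q idx m f x))" using int by (rule integrable_norm)
      show "integrable lebesgue (\<lambda>x. \<Sum>j\<in>UNIV. norm (f x $ j))"
        by (intro Bochner_Integration.integrable_sum f)
      show "norm (sd_dot q idx m f x) \<le> (\<Sum>j\<in>UNIV. norm (f x $ j))" for x
        unfolding sd_dot_def by (rule cmod_sum_sd_E_le)
    qed
    finally show ?thesis .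
  qed
  then show ?thesis unfolding bounded_iff by blast
qed

lemma sd_moment_diff:
  assumes "f \<in> L1" "g \<in> L1"
  shows "sd_moment q idx (\<lambda>x. f x - g x) m = sd_moment q idx f m - sd_moment q idx g m"
proof -
  have "sd_dot q idx m (\<lambda>x. f x - g x) = (\<lambda>x. sd_dot q idx m f x - sd_dot q idx m g x)"
    by (simp add: sd_dot_def fun_eq_iff right_diff_distrib sum_subtractf)
  then show ?thesis
    unfolding sd_moment_def by (simp add: Bochner_Integration.integral_diff integrable_sd_dot assms)
qed

lemma sd_norm_diff_eq:
  assumes "f \<in> L1" "g \<in> L1"
  shows "sd_norm q idx (\<lambda>x. f x - g x) = sqrt (square_sum (\<lambda>m. sd_moment q idx f m - sd_moment q idx g m))"
proof -
  have "sd_moment q idx (\<lambda>x. f x - g x) = (\<lambda>m. sd_moment q idx f m - sd_moment q idx g m)"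
    by (rule ext) (rule sd_moment_diff[OF assms])
  then show ?thesis
    unfolding sd_norm_def sd_inner_def
    by (simp only: Re_sd_form_self bounded_range_diff bounded_sd_moment assms)
qed

text \<open>
  Two approximations are composed: point masses that are correct to within \<open>sqrt (e / 4)\<close> in every moment, so
  to within \<open>e / 4\<close> in the weighted square sum, and a smearing of these masses with error \<open>e / 4\<close>. The
  constant 4 absorbs the factors 2 of the inequality for squares.
\<close>

lemma L1_approximates_HK_moments:
  fixes f :: "real ^ 'n \<Rightarrow> complex ^ 'n"
  assumes f: "f \<in> HK" and "e > 0"
  obtains g where "g \<in> L1" "square_sum (\<lambda>m. sd_moment q idx g m - hk_moment q idx f m) < e"
proof -
  define e' where "e' = sqrt (e / 4)"
  have "e' > 0" using \<open>e > 0\<close> by (simp add: e'_def)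
  obtain A :: "((real ^ 'n) \<times> (real ^ 'n) set) set" and x y
    where "finite A" and off: "\<And>a. a \<in> A \<Longrightarrow> y a = 0 \<or> (\<forall>j. x a $ j \<notin> cube_faces q)"
    and near: "\<And>m. cmod ((\<Sum>a\<in>A. \<Sum>j\<in>UNIV. sd_E q idx m (x a) $ j * y a $ j) - hk_moment q idx f m) < e'"
    by (rule hk_moment_uniform_point_masses[OF f countable_cube_faces \<open>e' > 0\<close>, where q = q and idx = idx]) (rule that)
  define P where "P m = (\<Sum>a\<in>A. \<Sum>j\<in>UNIV. sd_E q idx m (x a) $ j * y a $ j)" for m
  have "(\<lambda>l. square_sum (\<lambda>m. sd_moment q idx (smeared_masses A x y l) m - P m)) \<longlonglongrightarrow> 0"
    unfolding P_def by (rule square_sum_smeared_masses) (rule off)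
  then have "\<forall>\<^sub>F l in sequentially. square_sum (\<lambda>m. sd_moment q idx (smeared_masses A x y l) m - P m) < e / 4"
    by (rule order_tendstoD(2)) (use \<open>e > 0\<close> in simp)
  then obtain l where l: "square_sum (\<lambda>m. sd_moment q idx (smeared_masses A x y l) m - P m) < e / 4"
    unfolding eventually_sequentially by blast
  define g where "g = smeared_masses A x y l"
  have "g \<in> L1" unfolding g_def by (rule smeared_masses_L1)
  have "cmod (hk_moment q idx f m - P m) \<le> e'" for m
    using near[of m] unfolding P_def norm_minus_commute[of "hk_moment q idx f m"] by simp
  then have P2: "bounded (range (\<lambda>m. hk_moment q idx f m - P m))"
    unfolding bounded_iff by blast
  from bounded_range_diff[OF bounded_hk_moment[OF f, where q = q and idx = idx] P2] have "bounded (range P)" by simp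
  then have P1: "bounded (range (\<lambda>m. sd_moment q idx g m - P m))"
    by (intro bounded_range_diff bounded_sd_moment \<open>g \<in> L1\<close>)
  have "square_sum (\<lambda>m. hk_moment q idx f m - P m) \<le> (\<Sum>m. (1 / 2) ^ Suc m * (e / 4))"
    unfolding square_sum_def
  proof (rule suminf_le[OF _ summable_square_sum[OF P2]])
    show "summable (\<lambda>m. (1 / 2) ^ Suc m * (e / 4))"
      by (intro summable_mult2 summable_Suc_iff[THEN iffD2] summable_geometric) simp
    fix m
    have "(cmod (hk_moment q idx f (Suc m) - P (Suc m)))\<^sup>2 \<le> e'\<^sup>2"
      by (intro power_mono norm_ge_zero) fact
    also have "\<dots> = e / 4" using \<open>e > 0\<close> by (simp add: e'_def)
    finally show "1 / 2 ^ Suc m * (cmod (hk_moment q idx f (Suc m) - P (Suc m)))\<^sup>2 \<le> (1 / 2) ^ Suc m * (e / 4)"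
      unfolding power_one_over by (intro mult_left_mono) simp_all
  qed
  also have "\<dots> = e / 4"
    using sums_unique[OF sums_mult2[OF power_half_series, of "e / 4"]] by simp
  finally have "square_sum (\<lambda>m. hk_moment q idx f m - P m) \<le> e / 4" .
  moreover have "square_sum (\<lambda>m. (sd_moment q idx g m - P m) - (hk_moment q idx f m - P m))
      \<le> 2 * square_sum (\<lambda>m. sd_moment q idx g m - P m) + 2 * square_sum (\<lambda>m. hk_moment q idx f m - P m)"
    using P1 P2 by (rule square_sum_diff_le)
  ultimately have "square_sum (\<lambda>m. sd_moment q idx g m - hk_moment q idx f m) < e"
    using l unfolding g_def by simp
  with \<open>g \<in> L1\<close> show thesis by (rule that)
qed

lemma tendsto_zero_le_sum:
  fixes a b c :: "nat \<Rightarrow> real"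
  assumes "\<And>l. 0 \<le> c l" "\<And>l. c l \<le> 2 * a l + 2 * b l" "a \<longlonglongrightarrow> 0" "b \<longlonglongrightarrow> 0"
  shows "c \<longlonglongrightarrow> 0"
proof (rule real_tendsto_sandwich[OF _ _ tendsto_const])
  have "(\<lambda>l. 2 * a l + 2 * b l) \<longlonglongrightarrow> 2 * 0 + 2 * 0"
    using assms(3,4) by (intro tendsto_add tendsto_mult tendsto_const)
  then show "(\<lambda>l. 2 * a l + 2 * b l) \<longlonglongrightarrow> 0" by simp
qed (use assms(1,2) in simp_all)

lemma tendsto_sqrt_zero_iff:
  fixes a :: "nat \<Rightarrow> real"
  assumes "\<And>l. 0 \<le> a l"
  shows "(\<lambda>l. sqrt (a l)) \<longlonglongrightarrow> 0 \<longleftrightarrow> a \<longlonglongrightarrow> 0"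
proof
  assume "(\<lambda>l. sqrt (a l)) \<longlonglongrightarrow> 0"
  then have "(\<lambda>l. (sqrt (a l))\<^sup>2) \<longlonglongrightarrow> 0\<^sup>2" by (rule tendsto_power)
  then show "a \<longlonglongrightarrow> 0" using assms by simp
next
  assume "a \<longlonglongrightarrow> 0"
  then have "(\<lambda>l. sqrt (a l)) \<longlonglongrightarrow> sqrt 0" by (rule tendsto_real_sqrt)
  then show "(\<lambda>l. sqrt (a l)) \<longlonglongrightarrow> 0" by simp
qed

lemma sd_class_iff:
  fixes f :: "real ^ 'n \<Rightarrow> complex ^ 'n"
  assumes f: "f \<in> HK"
  shows "X \<in> sd_class q idx f \<longleftrightarrow> (\<forall>l. X l \<in> L1) \<and>
    (\<lambda>l. square_sum (\<lambda>m. sd_moment q idx (X l) m - hk_moment q idx f m)) \<longlonglongrightarrow> 0"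
proof -
  have "(\<lambda>l. sqrt (Re (sd_form (\<lambda>m. sd_moment q idx (X l) m - hk_moment q idx f m)
        (\<lambda>m. sd_moment q idx (X l) m - hk_moment q idx f m)))) \<longlonglongrightarrow> 0 \<longleftrightarrow>
      (\<lambda>l. square_sum (\<lambda>m. sd_moment q idx (X l) m - hk_moment q idx f m)) \<longlonglongrightarrow> 0"
    if "\<forall>l. X l \<in> L1"
  proof -
    have b: "bounded (range (\<lambda>m. sd_moment q idx (X l) m - hk_moment q idx f m))" for l
      using that by (intro bounded_range_diff bounded_sd_moment bounded_hk_moment f) blast
    show ?thesis
      by (simp only: Re_sd_form_self[OF b] tendsto_sqrt_zero_iff[OF square_sum_nonneg[OF b]])
  qed
  then show ?thesis
    unfolding sd_class_def Let_def mem_Collect_eq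
    using hk_integrable_sd_dot[OF f, where q = q and idx = idx] summable_square_sum[OF bounded_hk_moment[OF f, where q = q and idx = idx]]
    by blast
qed

lemma sd_class_nonempty:
  fixes f :: "real ^ 'n \<Rightarrow> complex ^ 'n"
  assumes f: "f \<in> HK"
  obtains X where "X \<in> sd_class q idx f"
proof -
  have "\<forall>l::nat. \<exists>g. g \<in> L1 \<and> square_sum (\<lambda>m. sd_moment q idx g m - hk_moment q idx f m) < 1 / real (Suc l)"
  proof
    fix l :: nat
    obtain g where "g \<in> L1" "square_sum (\<lambda>m. sd_moment q idx g m - hk_moment q idx f m) < 1 / real (Suc l)"
      by (rule L1_approximates_HK_moments[OF f, where e = "1 / real (Suc l)" and q = q and idx = idx]) (simp, rule that)
    then show "\<exists>g. g \<in> L1 \<and> square_sum (\<lambda>m. sd_moment q idx g m - hk_moment q idx f m) < 1 / real (Suc l)"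
      by (intro exI conjI)
  qed
  from choice[OF this] obtain X where X: "\<forall>l. X l \<in> L1 \<and> square_sum (\<lambda>m. sd_moment q idx (X l) m - hk_moment q idx f m) < 1 / real (Suc l)"
    by (elim exE)
  have "(\<lambda>l. square_sum (\<lambda>m. sd_moment q idx (X l) m - hk_moment q idx f m)) \<longlonglongrightarrow> 0"
  proof (rule real_tendsto_sandwich[OF _ _ tendsto_const])
    show "\<forall>\<^sub>F l in sequentially. 0 \<le> square_sum (\<lambda>m. sd_moment q idx (X l) m - hk_moment q idx f m)"
      using X by (intro always_eventually allI square_sum_nonneg bounded_range_diff bounded_sd_moment bounded_hk_moment f) blast
    show "\<forall>\<^sub>F l in sequentially. square_sum (\<lambda>m. sd_moment q idx (X l) m - hk_moment q idx f m) \<le> 1 / real (Suc l)"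
      using X by (intro always_eventually allI less_imp_le) blast
    show "(\<lambda>l. 1 / real (Suc l)) \<longlonglongrightarrow> 0"
      using LIMSEQ_Suc[OF lim_const_over_n[of "1::real"]] by simp
  qed
  with X have "X \<in> sd_class q idx f" unfolding sd_class_iff[OF f] by blast
  then show thesis by (rule that)
qed

lemma sd_class_Cauchy:
  fixes f :: "real ^ 'n \<Rightarrow> complex ^ 'n"
  assumes f: "f \<in> HK" and X: "X \<in> sd_class q idx f"
  shows "X \<in> sd_Cauchy q idx"
proof -
  let ?s = "\<lambda>l. square_sum (\<lambda>m. sd_moment q idx (X l) m - hk_moment q idx f m)"
  have L1: "\<And>l. X l \<in> L1" and lim: "?s \<longlonglongrightarrow> 0"
    using X unfolding sd_class_iff[OF f] by blast+
  have b: "bounded (range (\<lambda>m. sd_moment q idx (X l) m - hk_moment q idx f m))" for l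
    by (intro bounded_range_diff bounded_sd_moment bounded_hk_moment f L1)
  have le: "square_sum (\<lambda>m. sd_moment q idx (X l) m - sd_moment q idx (X l') m) \<le> 2 * ?s l + 2 * ?s l'" for l l'
    using square_sum_diff_le[OF b[of l] b[of l']] by simp
  have "\<exists>N. \<forall>l\<ge>N. \<forall>l'\<ge>N. sd_norm q idx (\<lambda>x. X l x - X l' x) < e" if "e > 0" for e
  proof -
    have "e\<^sup>2 / 4 > 0" using \<open>e > 0\<close> by simp
    with lim have "\<forall>\<^sub>F l in sequentially. ?s l < e\<^sup>2 / 4" by (rule order_tendstoD)
    then obtain N where N: "\<forall>l\<ge>N. ?s l < e\<^sup>2 / 4" unfolding eventually_sequentially by (elim exE)
    show ?thesis
    proof (intro exI[of _ N] allI impI)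
      fix l l' assume "N \<le> l" "N \<le> l'"
      have "square_sum (\<lambda>m. sd_moment q idx (X l) m - sd_moment q idx (X l') m) < e\<^sup>2"
        using le[of l l'] N[THEN spec, THEN mp, OF \<open>N \<le> l\<close>] N[THEN spec, THEN mp, OF \<open>N \<le> l'\<close>] by linarith
      then show "sd_norm q idx (\<lambda>x. X l x - X l' x) < e"
        unfolding sd_norm_diff_eq[OF L1 L1] using \<open>e > 0\<close> by (intro real_less_lsqrt) simp_all
    qed
  qed
  with L1 show ?thesis unfolding sd_Cauchy_def by blast
qed

theorem lemma4p10:
  fixes q :: "nat \<Rightarrow> real ^ 'n"
    and idx :: "nat \<Rightarrow> nat \<times> nat"
  assumes "bij_betw q {1..} {x. \<forall>j. x $ j \<in> \<rat>}"
    and "bij_betw idx {1..} ({1..} \<times> {1..})"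
  shows "sd_class q idx ` (HK :: (real ^ 'n \<Rightarrow> complex ^ 'n) set) \<subseteq> SD2 q idx"
proof (rule image_subsetI)
  fix f :: "real ^ 'n \<Rightarrow> complex ^ 'n" assume f: "f \<in> HK"
  obtain X where X: "X \<in> sd_class q idx f"
    by (rule sd_class_nonempty[OF f, where q = q and idx = idx]) (rule that)
  have L1: "Y l \<in> L1" if "Y \<in> sd_class q idx f" for Y l
    using that unfolding sd_class_iff[OF f] by blast
  let ?s = "\<lambda>Y l. square_sum (\<lambda>m. sd_moment q idx (Y l) m - hk_moment q idx f m)"
  have b: "bounded (range (\<lambda>m. sd_moment q idx g m - hk_moment q idx f m))" if "g \<in> L1" for g
    using that by (intro bounded_range_diff bounded_sd_moment bounded_hk_moment f)
  have b': "bounded (range (\<lambda>m. sd_moment q idx g m - sd_moment q idx h m))" if "g \<in> L1" "h \<in> L1" for g h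
    using that by (intro bounded_range_diff bounded_sd_moment)
  have "sd_class q idx f = sd_null_rel q idx `` {X}"
  proof (intro equalityI subsetI)
    fix Y assume Y: "Y \<in> sd_class q idx f"
    have "(\<lambda>l. square_sum (\<lambda>m. sd_moment q idx (X l) m - sd_moment q idx (Y l) m)) \<longlonglongrightarrow> 0"
    proof (rule tendsto_zero_le_sum)
      show "?s X \<longlonglongrightarrow> 0" "?s Y \<longlonglongrightarrow> 0"
        using X Y unfolding sd_class_iff[OF f] by blast+
      show "square_sum (\<lambda>m. sd_moment q idx (X l) m - sd_moment q idx (Y l) m) \<le> 2 * ?s X l + 2 * ?s Y l" for l
        using square_sum_diff_le[OF b[OF L1[OF X]] b[OF L1[OF Y]], of l l] by simp
      show "0 \<le> square_sum (\<lambda>m. sd_moment q idx (X l) m - sd_moment q idx (Y l) m)" for l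
        by (intro square_sum_nonneg b' L1 X Y)
    qed
    then have "(\<lambda>l. sd_norm q idx (\<lambda>x. X l x - Y l x)) \<longlonglongrightarrow> 0"
      by (simp only: sd_norm_diff_eq[OF L1[OF X] L1[OF Y]] tendsto_sqrt_zero_iff[OF square_sum_nonneg[OF b'[OF L1[OF X] L1[OF Y]]]])
    then show "Y \<in> sd_null_rel q idx `` {X}"
      using sd_class_Cauchy[OF f X] sd_class_Cauchy[OF f Y] unfolding sd_null_rel_def by blast
  next
    fix Y assume "Y \<in> sd_null_rel q idx `` {X}"
    then have "Y \<in> sd_Cauchy q idx" and lim: "(\<lambda>l. sd_norm q idx (\<lambda>x. X l x - Y l x)) \<longlonglongrightarrow> 0"
      unfolding sd_null_rel_def by blast+
    then have Y: "Y l \<in> L1" for l unfolding sd_Cauchy_def by blast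
    have lim': "(\<lambda>l. square_sum (\<lambda>m. sd_moment q idx (X l) m - sd_moment q idx (Y l) m)) \<longlonglongrightarrow> 0"
      using lim by (simp only: sd_norm_diff_eq[OF L1[OF X] Y] tendsto_sqrt_zero_iff[OF square_sum_nonneg[OF b'[OF L1[OF X] Y]]])
    have "?s Y \<longlonglongrightarrow> 0"
    proof (rule tendsto_zero_le_sum[OF _ _ _ lim'])
      show "?s X \<longlonglongrightarrow> 0" using X unfolding sd_class_iff[OF f] by blast
      show "?s Y l \<le> 2 * ?s X l + 2 * square_sum (\<lambda>m. sd_moment q idx (X l) m - sd_moment q idx (Y l) m)" for l
        using square_sum_diff_le[OF b[OF L1[OF X]] b'[OF L1[OF X] Y], of l l l] by simp
      show "0 \<le> ?s Y l" for l by (intro square_sum_nonneg b Y)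
    qed
    then show "Y \<in> sd_class q idx f" unfolding sd_class_iff[OF f] using Y by blast
  qed
  moreover have "sd_null_rel q idx `` {X} \<in> SD2 q idx"
    unfolding SD2_def by (rule quotientI[OF sd_class_Cauchy[OF f X]])
  ultimately show "sd_class q idx f \<in> SD2 q idx" by simp
qed

end
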